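(* Let $L$ be an oriented link diagram with a chosen basepoint on $L$ (away from the double points), let $\mathcal{C}_{BN}=\mathcal{C}_{BN}(L)$ be its Bar-Natan complex over $\mathbb{F}_2[H]$, and let $\mathcal{C}_x$ and $\mathcal{C}_1$ be the associated reduced complexes (the subcomplex in which the basepoint circle is labelled $\boldsymbol{x}$, and the quotient complex $\mathcal{C}_{BN}/\mathcal{C}_x$, respectively). Then, as graded chain complexes over $\mathbb{F}_2[H]$, $\mathcal{C}_1\cong\mathcal{C}_x$. Therefore, the Bar-Natan homology is the direct sum of two copies of the same (that is, isomorphic) reduced theories: $H(\mathcal{C}_{BN})\cong H(\mathcal{C}_x)\oplus H(\mathcal{C}_1)$ as $\mathbb{F}_2[H]$-modules with $H(\mathcal{C}_1)\cong H(\mathcal{C}_x)$, where $H(\cdot)$ applied to a complex denotes its homology.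
   Context: Let $\mathbb{F}_2$ be the field with two elements and $H$ a formal variable of quantum degree $-2$. For an $\mathbb{F}_2$-vector space $V$, $V[H]$ denotes the $\mathbb{F}_2[H]$-module of finite formal sums $\sum_{i\ge 0}H^i v_i$ with $v_i\in V$. **Resolutions.** Let $L$ be an oriented link diagram in the plane with $n=n_++n_-$ double points (crossings), $n_+$ positive and $n_-$ negative, ordered arbitrarily as $1,\dots,n$. Each crossing has a $0$-resolution and a $1$-resolution: the $0$-resolution is the smoothing that joins the two regions swept out when the overstrand is rotated counterclockwise until it meets the understrand, and the $1$-resolution is the other smoothing. (Equivalently, the orientation-respecting smoothing is the $0$-resolution of a positive crossing and the $1$-resolution of a negative crossing.) For $\alpha\in\{0,1\}^n$, let $D_\alpha(L)$ be the collection of disjoint circles in the plane obtained by giving crossing $j$ its $\alpha_j$-resolution for every $j$. Let $W$ be the $2$-dimensional $\mathbb{F}_2$-vector space with basis $\boldsymbol{1},\boldsymbol{x}$, and let $V_\alpha(L)=W^{\otimes k}$, with one tensor factor for each of the $k$ circles of $D_\alpha(L)$. A basis of $V_\alpha(L)$ is given by the labellings of the circles of $D_\alpha(L)$ by $\boldsymbol{1}$ and $\boldsymbol{x}$; for such a labelling $v$, $gr(v)$ is the number of $\boldsymbol{1}$'s minus the number of $\boldsymbol{x}$'s. **Chain groups and quantum grading.** $C_i=\bigoplus_{\alpha:\,w(\alpha)=i+n_-}V_\alpha(L)$, where $w(\alpha)$ is the number of $1$'s in $\alpha$. A labelling $v\in C_i$ has quantum grading $q(v)=gr(v)+i+n_+-n_-$,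 and $H^k v\in C_i[H]$ has quantum grading $q(v)-2k$. **Edge maps.** If $\beta$ is obtained from $\alpha$ by changing one coordinate from $0$ to $1$, then passing from $D_\alpha(L)$ to $D_\beta(L)$ either merges two circles into one (a merge) or splits one circle into two (a split), and leaves the other circles unchanged. Define $d_{\alpha,\beta},h_{\alpha,\beta}:V_\alpha(L)\to V_\beta(L)$ to be the identity on the tensor factors of the unchanged circles and, on the circles involved, $d_{\alpha,\beta}$ is $m$ for a merge and $\Delta$ for a split, while $h_{\alpha,\beta}$ is $m'$ for a merge and $\Delta'$ for a split, where - $m(\boldsymbol{1}\otimes\boldsymbol{1})=\boldsymbol{1}$, $m(\boldsymbol{1}\otimes\boldsymbol{x})=m(\boldsymbol{x}\otimes\boldsymbol{1})=\boldsymbol{x}$, $m(\boldsymbol{x}\otimes\boldsymbol{x})=0$; - $\Delta(\boldsymbol{1})=\boldsymbol{1}\otimes\boldsymbol{x}+\boldsymbol{x}\otimes\boldsymbol{1}$, $\Delta(\boldsymbol{x})=\boldsymbol{x}\otimes\boldsymbol{x}$; - $m'(\boldsymbol{x}\otimes\boldsymbol{x})=\boldsymbol{x}$, and $m'$ is $0$ on the other basis vectors; - $\Delta'(\boldsymbol{1})=\boldsymbol{1}\otimes\boldsymbol{1}$, $\Delta'(\boldsymbol{x})=0$. Let $d_i,h_i:C_i\to C_{i+1}$ be the sums of all $d_{\alpha,\beta}$, respectively $h_{\alpha,\beta}$, over edges $\alpha\to\beta$ with $w(\alpha)=i+n_-$ and $w(\beta)=i+1+n_-$. **Bar-Natan complex.**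 $\mathcal{C}_{BN}(L)=(C_*[H],\,d_*+Hh_* )$, a complex of graded $\mathbb{F}_2[H]$-modules (the differential squares to zero, raises the homological degree $i$ by $1$, and preserves the quantum grading). Its homology is the Bar-Natan homology. **Reduced complexes.** Fix a basepoint on $L$ away from the double points and keep its position in each $D_\alpha(L)$; the circle containing it is the basepoint circle. Let $\mathcal{C}_x$ and $\mathcal{C}_1$ be the $\mathbb{F}_2[H]$-submodules of $\mathcal{C}_{BN}$ spanned by the labellings in which the basepoint circle is labelled $\boldsymbol{x}$ and $\boldsymbol{1}$, respectively, with the gradings inherited from $\mathcal{C}_{BN}$. $\mathcal{C}_x$ is a subcomplex of $\mathcal{C}_{BN}$. As a module $\mathcal{C}_1$ is identified with the quotient $\mathcal{C}_{BN}/\mathcal{C}_x$ and it is given the quotient differential, i.e. $d+Hh$ followed by the projection $\mathcal{C}_{BN}\to\mathcal{C}_{BN}/\mathcal{C}_x\cong\mathcal{C}_1$. The homologies $H(\mathcal{C}_x)$ and $H(\mathcal{C}_1)$ are called the reduced Bar-Natan theories.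
   Formalization: The isomorphism of graded complexes is stated after shifting the quantum grading of C_1 by −2; with the inherited gradings it fails already for the unknot, where C_1 and C_x are free on one generator of degree +1 and −1 respectively. *)

theory Defs
  imports
    "HOL-Algebra.Coset"
    "HOL-Algebra.AbelCoset"
    "HOL-Algebra.Module"
    "HOL-Library.Z2"
    "HOL-Library.FuncSet"
    "HOL-Library.Function_Algebras"
    "HOL-Computational_Algebra.Polynomial"
begin

section \<open>Modules and graded complexes\<close>

text \<open>
  The field with two elements is \<^typ>\<open>bit\<close>, and \<open>\<bbbF>\<^sub>2[H]\<close> is \<^typ>\<open>bit poly\<close>. As in the
  library's own module records, the fields \<^const>\<open>monoid.mult\<close> and \<^const>\<open>one\<close> that a module
  record inherits from rings are irrelevant and left undefined.
\<close>

definition F2H :: "bit poly ring" where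
  "F2H = \<lparr>carrier = UNIV, monoid.mult = (*), one = 1, zero = 0, add = (+)\<rparr>"

definition H_var :: "bit poly" where
  "H_var = [:0, 1:]"

definition module_iso ::
    "('r, 'k) ring_scheme \<Rightarrow> ('r, 'a) module \<Rightarrow> ('r, 'b) module \<Rightarrow> ('a \<Rightarrow> 'b) set" where
  "module_iso R M N = {f \<in> iso (add_monoid M) (add_monoid N).
     \<forall>r \<in> carrier R. \<forall>x \<in> carrier M. f (r \<odot>\<^bsub>M\<^esub> x) = r \<odot>\<^bsub>N\<^esub> f x}"

definition modules_isomorphic ::
    "('r, 'k) ring_scheme \<Rightarrow> ('r, 'a) module \<Rightarrow> ('r, 'b) module \<Rightarrow> bool" where
  "modules_isomorphic R M N \<longleftrightarrow> module_iso R M N \<noteq> {}"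

definition direct_sum :: "('r, 'a) module \<Rightarrow> ('r, 'b) module \<Rightarrow> ('r, 'a \<times> 'b) module" where
  "direct_sum M N =
     \<lparr>carrier = carrier M \<times> carrier N, monoid.mult = undefined, one = undefined,
      zero = (\<zero>\<^bsub>M\<^esub>, \<zero>\<^bsub>N\<^esub>),
      add = (\<lambda>(x, y) (x', y'). (x \<oplus>\<^bsub>M\<^esub> x', y \<oplus>\<^bsub>N\<^esub> y')),
      module.smult = (\<lambda>r (x, y). (r \<odot>\<^bsub>M\<^esub> x, r \<odot>\<^bsub>N\<^esub> y))\<rparr>"

definition quotient_module :: "('r, 'a) module \<Rightarrow> 'a set \<Rightarrow> ('r, 'a set) module" where
  "quotient_module M N =
     \<lparr>carrier = a_rcosets\<^bsub>M\<^esub> N, monoid.mult = undefined, one = undefined,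
      zero = N, add = set_add M,
      module.smult = (\<lambda>r A. \<Union>a\<in>A. N +>\<^bsub>M\<^esub> (r \<odot>\<^bsub>M\<^esub> a))\<rparr>"

text \<open>
  A cohomologically graded complex of modules with a second (quantum) grading:
  \<open>homog C i q\<close> is the set of elements of \<open>C\<^sub>i\<close> that are homogeneous of quantum degree \<open>q\<close>.
\<close>

record ('r, 'a) graded_complex =
  chain_module :: "int \<Rightarrow> ('r, 'a) module"
  bdry :: "int \<Rightarrow> 'a \<Rightarrow> 'a"
  homog :: "int \<Rightarrow> int \<Rightarrow> 'a set"

definition cycles :: "('r, 'a) graded_complex \<Rightarrow> int \<Rightarrow> 'a set" where
  "cycles C i = {x \<in> carrier (chain_module C i). bdry C i x = \<zero>\<^bsub>chain_module C (i + 1)\<^esub>}"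

definition boundaries :: "('r, 'a) graded_complex \<Rightarrow> int \<Rightarrow> 'a set" where
  "boundaries C i = bdry C (i - 1) ` carrier (chain_module C (i - 1))"

definition homology :: "('r, 'a) graded_complex \<Rightarrow> int \<Rightarrow> ('r, 'a set) module" where
  "homology C i =
     quotient_module ((chain_module C i)\<lparr>carrier := cycles C i\<rparr>) (boundaries C i)"

text \<open>
  An element of quantum degree \<open>q\<close> in \<open>C\<close> has quantum degree \<open>q + s\<close> in \<open>qshift s C\<close>. The two
  reduced Bar-Natan complexes can only agree up to such a shift: for the crossingless unknot the
  generators \<open>1\<close> and \<open>x\<close> have quantum degrees \<open>1\<close> and \<open>-1\<close>, so the shift is by \<open>-2\<close>.
\<close>

definition qshift :: "int \<Rightarrow> ('r, 'a) graded_complex \<Rightarrow> ('r, 'a) graded_complex" where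
  "qshift s C = C\<lparr>homog := (\<lambda>i q. homog C i (q - s))\<rparr>"

definition graded_complexes_isomorphic ::
    "('r, 'k) ring_scheme \<Rightarrow> ('r, 'a) graded_complex \<Rightarrow> ('r, 'b) graded_complex \<Rightarrow> bool" where
  "graded_complexes_isomorphic R C D \<longleftrightarrow>
     (\<exists>\<phi>. \<forall>i. \<phi> i \<in> module_iso R (chain_module C i) (chain_module D i) \<and>
        (\<forall>x \<in> carrier (chain_module C i). \<phi> (i + 1) (bdry C i x) = bdry D i (\<phi> i x)) \<and>
        (\<forall>q. \<phi> i ` homog C i q = homog D i q))"

section \<open>Oriented link diagrams\<close>

text \<open>
  A link diagram is given by its oriented planar diagram code. The crossings are
  \<open>0, \<dots>, n - 1\<close>. Cutting the link projection at the crossings leaves a set of arcs; components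
  without crossings contribute one (closed) arc each. The arcs at crossing \<open>j\<close> are
  \<open>leg L j 0, \<dots>, leg L j 3\<close>, listed counterclockwise around the crossing, starting from the
  incoming end of the understrand; so the understrand runs from position 0 to position 2. The
  overstrand runs from 3 to 1 if the crossing is positive, and from 1 to 3 if it is negative.
  A pair \<open>(j, k)\<close> is called a dart; it is the half-edge at position \<open>k\<close> of crossing \<open>j\<close>.
\<close>

record 'e diagram =
  crossings :: nat
  arcs :: "'e set"
  leg :: "nat \<Rightarrow> nat \<Rightarrow> 'e"
  positive :: "nat \<Rightarrow> bool"

definition darts :: "'e diagram \<Rightarrow> (nat \<times> nat) set" where
  "darts L = {..<crossings L} \<times> {..<4}"

definition arc_at :: "'e diagram \<Rightarrow> nat \<times> nat \<Rightarrow> 'e" where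
  "arc_at L = (\<lambda>(j, k). leg L j k)"

definition incoming :: "'e diagram \<Rightarrow> (nat \<times> nat) set" where
  "incoming L = {(j, k) \<in> darts L. k = 0 \<or> k = (if positive L j then 3 else 1)}"

definition outgoing :: "'e diagram \<Rightarrow> (nat \<times> nat) set" where
  "outgoing L = {(j, k) \<in> darts L. k = 2 \<or> k = (if positive L j then 1 else 3)}"

definition equiv_classes :: "'a set \<Rightarrow> ('a \<Rightarrow> 'a \<Rightarrow> bool) \<Rightarrow> 'a set set" where
  "equiv_classes A r = A // {(x, y). x \<in> A \<and> y \<in> A \<and> equivclp r x y}"

text \<open>
  Walking along the boundary of a face: traverse an arc from one of its darts to its other dart,
  then turn to the next dart around that crossing. On a well-formed diagram this is a permutation
  of the darts, whose orbits are the faces.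
\<close>

definition face_step :: "'e diagram \<Rightarrow> nat \<times> nat \<Rightarrow> nat \<times> nat \<Rightarrow> bool" where
  "face_step L d e \<longleftrightarrow> d \<in> darts L \<and>
     (\<exists>j k. (j, k) \<in> darts L \<and> (j, k) \<noteq> d \<and> arc_at L (j, k) = arc_at L d \<and>
        e = (j, (k + 1) mod 4))"

definition faces :: "'e diagram \<Rightarrow> (nat \<times> nat) set set" where
  "faces L = equiv_classes (darts L) (face_step L)"

definition pieces :: "'e diagram \<Rightarrow> (nat \<times> nat) set set" where
  "pieces L = equiv_classes (darts L) (\<lambda>d e. d \<in> darts L \<and> e \<in> darts L \<and>
     (fst d = fst e \<or> arc_at L d = arc_at L e))"

text \<open>
  Planarity of a rotation system: each connected piece has genus 0. Faces are counted separately
  for each piece, so the Euler characteristics \<open>2 - 2g\<close> of the pieces add up to twice the number of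
  pieces precisely if all the genera vanish. (The position of the pieces and of crossingless
  components relative to each other in the plane is not recorded; it is arbitrary.)
\<close>

definition planar :: "'e diagram \<Rightarrow> bool" where
  "planar L \<longleftrightarrow>
     int (crossings L) - int (card (arc_at L ` darts L)) + int (card (faces L))
       = 2 * int (card (pieces L))"

text \<open>Each arc that meets a crossing starts at exactly one dart and ends at exactly one dart.\<close>

definition oriented_link_diagram :: "'e diagram \<Rightarrow> bool" where
  "oriented_link_diagram L \<longleftrightarrow>
     finite (arcs L) \<and> arc_at L ` darts L \<subseteq> arcs L \<and>
     inj_on (arc_at L) (incoming L) \<and> inj_on (arc_at L) (outgoing L) \<and>
     arc_at L ` incoming L = arc_at L ` outgoing L \<and> planar L"

definition n_pos :: "'e diagram \<Rightarrow> nat" where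
  "n_pos L = card {j. j < crossings L \<and> positive L j}"

definition n_neg :: "'e diagram \<Rightarrow> nat" where
  "n_neg L = card {j. j < crossings L \<and> \<not> positive L j}"

section \<open>Resolutions\<close>

text \<open>
  A vertex \<open>\<alpha>\<close> of the cube is a list of \<^term>\<open>crossings L\<close> booleans, with \<^const>\<open>True\<close> for the
  1-resolution. Rotating the overstrand (positions 1 and 3) counterclockwise sweeps out the
  region between positions 1 and 2 and the region between positions 3 and 0; the 0-resolution
  joins these, hence it connects the ends 0 with 1 and 2 with 3.
\<close>

definition joined :: "'e diagram \<Rightarrow> bool list \<Rightarrow> 'e \<Rightarrow> 'e \<Rightarrow> bool" where
  "joined L \<alpha> a b \<longleftrightarrow> (\<exists>j < crossings L.
     if \<alpha> ! j then (a, b) \<in> {(leg L j 0, leg L j 3), (leg L j 1, leg L j 2)}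
     else (a, b) \<in> {(leg L j 0, leg L j 1), (leg L j 2, leg L j 3)})"

text \<open>A circle of a resolution is represented by the set of arcs it runs through.\<close>

definition circles :: "'e diagram \<Rightarrow> bool list \<Rightarrow> 'e set set" where
  "circles L \<alpha> = equiv_classes (arcs L) (joined L \<alpha>)"

definition base_circle :: "'e diagram \<Rightarrow> 'e \<Rightarrow> bool list \<Rightarrow> 'e set" where
  "base_circle L p \<alpha> = (THE c. c \<in> circles L \<alpha> \<and> p \<in> c)"

definition weight :: "bool list \<Rightarrow> nat" where
  "weight \<alpha> = count_list \<alpha> True"

definition cube_edge :: "bool list \<Rightarrow> bool list \<Rightarrow> bool" where
  "cube_edge \<alpha> \<beta> \<longleftrightarrow> (\<exists>j < length \<alpha>. \<not> \<alpha> ! j \<and> \<beta> = \<alpha>[j := True])"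

section \<open>The Bar-Natan complex\<close>

datatype label = L1 | LX

text \<open>
  A vector in the span of a finite basis is its coefficient function; \<open>W \<otimes> W\<close> has basis
  \<^typ>\<open>label \<times> label\<close>.
\<close>

definition ket :: "'b \<Rightarrow> 'b \<Rightarrow> bit" where
  "ket b = (\<lambda>b'. of_bool (b' = b))"

fun mW :: "label \<times> label \<Rightarrow> label \<Rightarrow> bit" where
  "mW (L1, L1) = ket L1"
| "mW (L1, LX) = ket LX"
| "mW (LX, L1) = ket LX"
| "mW (LX, LX) = 0"

fun \<Delta>W :: "label \<Rightarrow> label \<times> label \<Rightarrow> bit" where
  "\<Delta>W L1 = ket (L1, LX) + ket (LX, L1)"
| "\<Delta>W LX = ket (LX, LX)"

fun mW' :: "label \<times> label \<Rightarrow> label \<Rightarrow> bit" where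
  "mW' (L1, L1) = 0"
| "mW' (L1, LX) = 0"
| "mW' (LX, L1) = 0"
| "mW' (LX, LX) = ket LX"

fun \<Delta>W' :: "label \<Rightarrow> label \<times> label \<Rightarrow> bit" where
  "\<Delta>W' L1 = ket (L1, L1)"
| "\<Delta>W' LX = 0"

text \<open>
  A generator is a vertex of the cube together with a labelling of the circles of its
  resolution.
\<close>

type_synonym 'e generator = "bool list \<times> ('e set \<Rightarrow> label)"

definition generators :: "'e diagram \<Rightarrow> 'e generator set" where
  "generators L = {(\<alpha>, v). length \<alpha> = crossings L \<and> v \<in> circles L \<alpha> \<rightarrow>\<^sub>E UNIV}"

definition hdeg :: "'e diagram \<Rightarrow> 'e generator \<Rightarrow> int" where
  "hdeg L = (\<lambda>(\<alpha>, v). int (weight \<alpha>) - int (n_neg L))"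

definition gr :: "'e diagram \<Rightarrow> 'e generator \<Rightarrow> int" where
  "gr L = (\<lambda>(\<alpha>, v). int (card {c \<in> circles L \<alpha>. v c = L1}) - int (card {c \<in> circles L \<alpha>. v c = LX}))"

definition qdeg :: "'e diagram \<Rightarrow> 'e generator \<Rightarrow> int" where
  "qdeg L g = gr L g + hdeg L g + int (n_pos L) - int (n_neg L)"

text \<open>Passing from \<open>D\<^sub>\<alpha>\<close> to \<open>D\<^sub>\<beta>\<close> merges the circles \<open>c1\<close>, \<open>c2\<close> into \<open>c\<close>.\<close>

definition merges :: "'e diagram \<Rightarrow> bool list \<Rightarrow> bool list \<Rightarrow> 'e set \<Rightarrow> 'e set \<Rightarrow> 'e set \<Rightarrow> bool" where
  "merges L \<alpha> \<beta> c1 c2 c \<longleftrightarrow> c1 \<noteq> c2 \<and>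
     circles L \<alpha> - circles L \<beta> = {c1, c2} \<and> circles L \<beta> - circles L \<alpha> = {c}"

text \<open>
  The coefficient at the labelling \<open>w\<close> of \<open>D\<^sub>\<beta>\<close> of the image of the labelling \<open>v\<close> of \<open>D\<^sub>\<alpha>\<close> under
  the map that is \<open>\<mu>\<close> (for a merge) or \<open>\<delta>\<close> (for a split, that is, a merge from \<open>\<beta>\<close> to \<open>\<alpha>\<close>) on the
  circles involved and the identity on the others. All of \<open>mW\<close>, \<open>mW'\<close>, \<open>\<Delta>W\<close>, \<open>\<Delta>W'\<close> are symmetric,
  so the order of \<open>c1\<close> and \<open>c2\<close> does not matter.
\<close>

definition edge_coeff ::
    "(label \<times> label \<Rightarrow> label \<Rightarrow> bit) \<Rightarrow> (label \<Rightarrow> label \<times> label \<Rightarrow> bit) \<Rightarrow> 'e diagram \<Rightarrow>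
     'e generator \<Rightarrow> 'e generator \<Rightarrow> bit" where
  "edge_coeff \<mu> \<delta> L = (\<lambda>(\<alpha>, v) (\<beta>, w). of_bool
     ((\<forall>c \<in> circles L \<alpha> \<inter> circles L \<beta>. w c = v c) \<and>
      ((\<exists>c1 c2 c. merges L \<alpha> \<beta> c1 c2 c \<and> \<mu> (v c1, v c2) (w c) = 1) \<or>
       (\<exists>c1 c2 c. merges L \<beta> \<alpha> c1 c2 c \<and> \<delta> (v c) (w c1, w c2) = 1))))"

text \<open>
  The generators being finite in number, a chain (an element of \<open>C\<^sub>*[H]\<close>) is identified with its
  coefficient function from generators to \<open>\<bbbF>\<^sub>2[H]\<close>.
\<close>

type_synonym 'e chain = "'e generator \<Rightarrow> bit poly"

definition cube_map ::
    "(label \<times> label \<Rightarrow> label \<Rightarrow> bit) \<Rightarrow> (label \<Rightarrow> label \<times> label \<Rightarrow> bit) \<Rightarrow> 'e diagram \<Rightarrow>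
     'e chain \<Rightarrow> 'e chain" where
  "cube_map \<mu> \<delta> L x = (\<lambda>g'. if g' \<in> generators L
     then \<Sum>g \<in> {g \<in> generators L. cube_edge (fst g) (fst g')}. [:edge_coeff \<mu> \<delta> L g g':] * x g
     else 0)"

definition bn_diff :: "'e diagram \<Rightarrow> 'e chain \<Rightarrow> 'e chain" where
  "bn_diff L x = (\<lambda>g. cube_map mW \<Delta>W L x g + H_var * cube_map mW' \<Delta>W' L x g)"

definition free_module :: "'b set \<Rightarrow> ('r::comm_ring_1, 'b \<Rightarrow> 'r) module" where
  "free_module B =
     \<lparr>carrier = {x. \<forall>b. b \<notin> B \<longrightarrow> x b = 0}, monoid.mult = undefined, one = undefined,
      zero = (\<lambda>b. 0), add = (\<lambda>x y b. x b + y b), module.smult = (\<lambda>r x b. r * x b)\<rparr>"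

text \<open>
  The complex on the span of a set \<open>S\<close> of generators with differential \<open>D\<close> (in all homological
  degrees). Since \<open>H\<close> has quantum degree \<open>-2\<close>, the monomial \<open>H\<^sup>k g\<close> has quantum degree
  \<open>qdeg L g - 2k\<close>.
\<close>

definition complex_on ::
    "'e diagram \<Rightarrow> 'e generator set \<Rightarrow> ('e chain \<Rightarrow> 'e chain) \<Rightarrow> (bit poly, 'e chain) graded_complex"
  where
  "complex_on L S D =
     \<lparr>chain_module = (\<lambda>i. free_module {g \<in> S. hdeg L g = i}),
      bdry = (\<lambda>i. D),
      homog = (\<lambda>i q. {x \<in> carrier (free_module {g \<in> S. hdeg L g = i}).
        \<forall>g k. poly.coeff (x g) k \<noteq> 0 \<longrightarrow> qdeg L g - 2 * int k = q})\<rparr>"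

definition based_generators :: "'e diagram \<Rightarrow> 'e \<Rightarrow> label \<Rightarrow> 'e generator set" where
  "based_generators L p l = {(\<alpha>, v) \<in> generators L. v (base_circle L p \<alpha>) = l}"

definition proj :: "'e generator set \<Rightarrow> 'e chain \<Rightarrow> 'e chain" where
  "proj S x = (\<lambda>g. if g \<in> S then x g else 0)"

definition C_BN :: "'e diagram \<Rightarrow> (bit poly, 'e chain) graded_complex" where
  "C_BN L = complex_on L (generators L) (bn_diff L)"

definition C_x :: "'e diagram \<Rightarrow> 'e \<Rightarrow> (bit poly, 'e chain) graded_complex" where
  "C_x L p = complex_on L (based_generators L p LX) (bn_diff L)"

text \<open>
  The quotient complex \<open>C_BN / C_x\<close>, its module identified with the span of the generators with
  label \<open>1\<close> at the basepoint: the projection along \<open>C_x\<close> discards the other coefficients.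
\<close>

definition C_1 :: "'e diagram \<Rightarrow> 'e \<Rightarrow> (bit poly, 'e chain) graded_complex" where
  "C_1 L p = complex_on L (based_generators L p L1) (proj (based_generators L p L1) \<circ> bn_diff L)"

end

theory Submission
  imports Defs
begin

text \<open>
  The circles carry the Frobenius algebra \<open>A = R[x]/(x\<^sup>2 = H x)\<close> over \<open>R = \<bbbF>\<^sub>2[H]\<close>, and the
  differential is built from its multiplication and its comultiplication
  \<open>\<Delta>(1) = 1 \<otimes> x + x \<otimes> 1 + H 1 \<otimes> 1\<close>. In characteristic two \<open>x \<mapsto> x + H\<close> is an involution of
  this Frobenius algebra; applied to all circles at once it gives an automorphism \<open>\<sigma>\<close> of the
  Bar-Natan complex (\<open>conj_map\<close>). Multiplication by \<open>x\<close> on the circle through the basepoint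
  gives a chain map \<open>X\<close> (\<open>dot\<close>), and \<open>C\<^sub>x\<close> is both its image and the kernel of \<open>X + H\<close>. Hence
  \<open>X\<close> induces \<open>C/ker X = C/(x + H)C \<cong> C\<^sub>x\<close>, while \<open>C\<^sub>1 = C/xC\<close>. As \<open>\<sigma>\<close> exchanges the two
  ideals, \<open>X \<sigma>\<close> induces an isomorphism from \<open>C\<^sub>1\<close> to \<open>C\<^sub>x\<close>, of quantum degree \<open>-2\<close>.

  For the splitting, \<open>\<sigma>\<close> is the identity modulo \<open>H\<close>, so \<open>\<sigma> = 1 + H D\<close> for an operator \<open>D\<close>
  (\<open>conj_quot\<close>) of quantum degree \<open>2\<close>. At \<open>H = 0\<close> this is Shumakovitch's operator, which sums
  over all ways to turn one label \<open>x\<close> into \<open>1\<close>. The operators satisfy \<open>X\<^sup>2 = H X\<close>, \<open>D\<^sup>2 = 0\<close> and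
  \<open>D X = X D + 1 + H D\<close>. On \<open>C\<^sub>x\<close>, where \<open>X = H\<close>, the last relation becomes \<open>X D = 1\<close>: the chain
  map \<open>X D\<close> is a retraction of \<open>C\<close> onto \<open>C\<^sub>x\<close>. Together with the projection to \<open>C\<^sub>1\<close> it
  identifies \<open>C\<close> with \<open>C\<^sub>x \<oplus> C\<^sub>1\<close>. The same relations show that \<open>D\<close> followed by the
  projection to \<open>C\<^sub>1\<close> inverts \<open>X \<sigma>\<close>.

  The work lies in showing that \<open>X\<close> and \<open>D\<close> commute with the differential. For \<open>X\<close>, placed at an
  arbitrary arc, this is a comparison of matrix coefficients (\<open>edge_kernel_dot\<close>, \<open>dot_bn_diff\<close>).
  For \<open>D\<close>, the operators \<open>X\<close> at the various arcs generate all chains from the labellings by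
  \<open>1\<close> alone (\<open>dot_induct\<close>), and the commutation relation of \<open>D\<close> with \<open>X\<close> reduces the claim
  to those labellings (\<open>conj_quot_bn_diff_unit\<close>).
\<close>

section \<open>Chains as vectors in characteristic two\<close>

definition scale :: "bit poly \<Rightarrow> 'e chain \<Rightarrow> 'e chain" where
  "scale r x = (\<lambda>g. r * x g)"

text \<open>
  Operator identities are computed in the additive group of chains, so sums of chains should
  not be evaluated at generators unless this is asked for.
\<close>

declare plus_fun_apply [simp del] zero_fun_apply [simp del]

lemma bit_add_self: "b + b = (0 :: bit)"
  by (cases b) simp_all

lemma bit_poly_two [simp]: "2 = (0 :: bit poly)"
  by (simp add: numeral_poly)

lemma bit_poly_add_self [simp]: "p + p = (0 :: bit poly)"
  by (rule poly_eqI) (metis bit_add_self coeff_0 coeff_add)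

lemma bit_poly_add_cancel [simp]: "p + (p + q) = (q :: bit poly)"
  by (simp add: add.assoc [symmetric])

lemma scale_apply: "scale r x g = r * x g"
  by (simp add: scale_def)

lemmas chain_apply = plus_fun_apply zero_fun_apply scale_apply

lemma chain_add_self [simp]: "x + x = (0 :: 'e chain)"
  by (rule ext) (simp add: chain_apply)

lemma chain_add_cancel [simp]: "x + (x + y) = (y :: 'e chain)"
  by (simp add: add.assoc [symmetric])

lemma chain_add_eq_0_iff [simp]: "x + y = (0 :: 'e chain) \<longleftrightarrow> x = y"
  by (metis chain_add_cancel chain_add_self add_0_right)

lemma scale_add: "scale r (x + y) = scale r x + scale r y"
  by (simp add: fun_eq_iff chain_apply distrib_left)

lemma scale_zero: "scale r 0 = 0"
  by (simp add: fun_eq_iff chain_apply)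

lemma scale_scale: "scale r (scale s x) = scale (r * s) x"
  by (simp add: fun_eq_iff chain_apply mult.assoc)

definition linear_op :: "('e chain \<Rightarrow> 'f chain) \<Rightarrow> bool" where
  "linear_op F \<longleftrightarrow> (\<forall>x y. F (x + y) = F x + F y) \<and> (\<forall>r x. F (scale r x) = scale r (F x))"

lemma linear_op_add: "linear_op F \<Longrightarrow> F (x + y) = F x + F y"
  and linear_op_scale: "linear_op F \<Longrightarrow> F (scale r x) = scale r (F x)"
  by (simp_all add: linear_op_def)

lemma linear_op_zero: "linear_op F \<Longrightarrow> F 0 = 0"
  using linear_op_add [of F 0 0] by simp

lemma linear_op_comp: "linear_op F \<Longrightarrow> linear_op G \<Longrightarrow> linear_op (\<lambda>x. F (G x))"
  by (simp add: linear_op_def)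

section \<open>Circles and generators\<close>

definition supported :: "'e generator set \<Rightarrow> 'e chain set" where
  "supported S = {x. \<forall>g. g \<notin> S \<longrightarrow> x g = 0}"

lemma supported_add: "x \<in> supported S \<Longrightarrow> y \<in> supported S \<Longrightarrow> x + y \<in> supported S"
  and supported_scale: "x \<in> supported S \<Longrightarrow> scale r x \<in> supported S"
  and supported_zero: "0 \<in> supported S"
  by (simp_all add: supported_def chain_apply)

lemma equiv_circle_rel: "equiv A {(x, y). x \<in> A \<and> y \<in> A \<and> equivclp r x y}"
proof (rule equivI)
  let ?R = "{(x, y). x \<in> A \<and> y \<in> A \<and> equivclp r x y}"
  show "?R \<subseteq> A \<times> A" "refl_on A ?R" by (auto simp: refl_on_def)
  show "sym ?R" by (rule symI) (simp add: equivclp_sym)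
  show "trans ?R" by (rule transI) (auto elim: equivclp_trans)
qed

lemma circles_nonempty: "c \<in> circles L \<alpha> \<Longrightarrow> c \<noteq> {}"
  and circles_subset: "c \<in> circles L \<alpha> \<Longrightarrow> c \<subseteq> arcs L"
  unfolding circles_def equiv_classes_def
  by (fact in_quotient_imp_non_empty [OF equiv_circle_rel],
      fact in_quotient_imp_subset [OF equiv_circle_rel])

lemma circles_unique:
  assumes "c \<in> circles L \<alpha>" "c' \<in> circles L \<alpha>" "a \<in> c" "a \<in> c'"
  shows "c = c'"
  using quotient_disj [OF equiv_circle_rel] assms
  unfolding circles_def equiv_classes_def by blast

lemma ex_circle: "a \<in> arcs L \<Longrightarrow> \<exists>c \<in> circles L \<alpha>. a \<in> c"
  using Union_quotient [OF equiv_circle_rel, of "arcs L" "joined L \<alpha>"]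
  unfolding circles_def equiv_classes_def by blast

lemma base_circle_eq: "c \<in> circles L \<alpha> \<Longrightarrow> a \<in> c \<Longrightarrow> base_circle L a \<alpha> = c"
  unfolding base_circle_def by (rule the_equality) (auto dest: circles_unique)

lemma base_circle_in:
  assumes "a \<in> arcs L"
  shows "base_circle L a \<alpha> \<in> circles L \<alpha>" and "a \<in> base_circle L a \<alpha>"
  using ex_circle [OF assms, of \<alpha>] base_circle_eq by metis+

lemma base_circle_common:
  assumes "a \<in> arcs L" "base_circle L a \<alpha> \<in> circles L \<beta>"
  shows "base_circle L a \<beta> = base_circle L a \<alpha>"
  using assms base_circle_eq base_circle_in(2) by metis

lemma finite_circles: "finite (arcs L) \<Longrightarrow> finite (circles L \<alpha>)"
  unfolding circles_def equiv_classes_def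
  by (rule finite_quotient [rotated]) (auto simp: finite_subset)

lemma finite_generators:
  assumes "finite (arcs L)"
  shows "finite (generators L)"
proof -
  have "generators L = (SIGMA \<alpha>:{\<alpha>. length \<alpha> = crossings L}. circles L \<alpha> \<rightarrow>\<^sub>E UNIV)"
    by (auto simp: generators_def)
  moreover have "finite {\<alpha> :: bool list. length \<alpha> = crossings L}"
    using finite_lists_length_eq [of "UNIV :: bool set"] by simp
  moreover have "finite (UNIV :: label set)"
  proof -
    have "UNIV = {L1, LX}" using label.exhaust by auto
    then show ?thesis by (metis finite.emptyI finite_insert)
  qed
  ultimately show ?thesis
    using finite_circles [OF assms] by (auto intro!: finite_SigmaI finite_PiE)
qed

text \<open>
  The operators below are given by coordinate formulas that do not mention the set of
  generators; relabelling actual circles cannot leave or enter that set, so they preserve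
  supports.
\<close>

lemma generators_upd_iff:
  assumes "c \<in> circles L \<alpha>"
  shows "(\<alpha>, v(c := l)) \<in> generators L \<longleftrightarrow> (\<alpha>, v) \<in> generators L"
  using assms by (auto simp: generators_def PiE_iff extensional_def)

definition basis_chain :: "'e generator \<Rightarrow> 'e chain" where
  "basis_chain g = (\<lambda>g'. of_bool (g' = g))"

lemma basis_chain_supported: "g \<in> S \<Longrightarrow> basis_chain g \<in> supported S"
  by (auto simp: supported_def basis_chain_def)

lemma supported_induct:
  assumes fin: "finite S" and x: "x \<in> supported S"
    and zero: "P 0" and add: "\<And>x y. P x \<Longrightarrow> P y \<Longrightarrow> P (x + y)"
    and scale: "\<And>r x. P x \<Longrightarrow> P (scale r x)" and basis: "\<And>g. g \<in> S \<Longrightarrow> P (basis_chain g)"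
  shows "P x"
  using fin x basis
proof (induction S arbitrary: x rule: finite_induct)
  case empty
  then have "x = 0" by (auto simp: supported_def fun_eq_iff chain_apply)
  then show ?case using zero by simp
next
  case (insert g S)
  have "x(g := 0) \<in> supported S"
    using insert.prems(1) by (auto simp: supported_def)
  then have "P (x(g := 0))"
    using insert.IH insert.prems(2) by blast
  moreover have "P (scale (x g) (basis_chain g))"
    using insert.prems(2) scale by blast
  moreover have "x = x(g := 0) + scale (x g) (basis_chain g)"
    by (auto simp: basis_chain_def fun_eq_iff chain_apply)
  ultimately show ?case using add by metis
qed

lemma linear_op_eqI:
  assumes "finite S" "x \<in> supported S" "linear_op F" "linear_op G"
    and "\<And>g. g \<in> S \<Longrightarrow> F (basis_chain g) = G (basis_chain g)"
  shows "F x = G x"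
  using assms(1,2)
proof (rule supported_induct)
  show "F 0 = G 0" using assms(3,4) by (simp add: linear_op_zero)
qed (simp_all add: assms(5) linear_op_add [OF assms(3)] linear_op_add [OF assms(4)]
    linear_op_scale [OF assms(3)] linear_op_scale [OF assms(4)])

section \<open>Multiplication by x along an arc\<close>

text \<open>
  In coordinates: since \<open>x \<cdot> 1 = x\<close> and \<open>x \<cdot> x = H x\<close>, a label \<open>x\<close> on the circle through \<open>a\<close> arises
  from either label, and a label \<open>1\<close> never does.
\<close>

definition dot :: "'e diagram \<Rightarrow> 'e \<Rightarrow> 'e chain \<Rightarrow> 'e chain" where
  "dot L a x = (\<lambda>(\<alpha>, v). if v (base_circle L a \<alpha>) = LX
     then x (\<alpha>, v(base_circle L a \<alpha> := L1)) + H_var * x (\<alpha>, v) else 0)"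

lemma linear_op_dot: "linear_op (dot L a)"
  by (auto simp: linear_op_def dot_def fun_eq_iff chain_apply algebra_simps)

lemma dot_supported:
  assumes "a \<in> arcs L" "x \<in> supported {g \<in> generators L. hdeg L g = i}"
  shows "dot L a x \<in> supported {g \<in> generators L. hdeg L g = i}"
  using assms generators_upd_iff [OF base_circle_in(1) [OF assms(1)]]
  by (auto simp: supported_def dot_def hdeg_def)

lemma dot_supported_generators:
  assumes "a \<in> arcs L" "x \<in> supported (generators L)"
  shows "dot L a x \<in> supported (generators L)"
  using assms generators_upd_iff [OF base_circle_in(1) [OF assms(1)]]
  by (auto simp: supported_def dot_def)

lemma dot_dot: "dot L a (dot L a x) = scale H_var (dot L a x)"
  by (auto simp: dot_def fun_eq_iff chain_apply)

lemma dot_basis_chain: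
  "dot L a (basis_chain (\<alpha>, v)) =
    (if v (base_circle L a \<alpha>) = L1 then basis_chain (\<alpha>, v(base_circle L a \<alpha> := LX))
     else scale H_var (basis_chain (\<alpha>, v)))"
proof -
  have "w(c := L1) = v \<longleftrightarrow> w = v(c := LX)" if "w c = LX" "v c = L1" for w and c :: "'a set"
    using that by (metis fun_upd_triv fun_upd_upd)
  then show ?thesis
    by (auto simp: fun_eq_iff chain_apply dot_def basis_chain_def split: prod.splits)
       (metis label.exhaust fun_upd_same label.distinct)+
qed

definition unit_labelling :: "'e diagram \<Rightarrow> bool list \<Rightarrow> 'e set \<Rightarrow> label" where
  "unit_labelling L \<alpha> = (\<lambda>c \<in> circles L \<alpha>. L1)"

lemma unit_labelling_generator:
  "(\<alpha>, unit_labelling L \<alpha>) \<in> generators L \<longleftrightarrow> length \<alpha> = crossings L"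
  by (auto simp: generators_def unit_labelling_def)

text \<open>
  Every labelling is obtained from the all-\<open>1\<close> labelling by multiplying with \<open>x\<close> at one arc of
  each circle labelled \<open>x\<close>.
\<close>

lemma dot_induct [consumes 2, case_names zero add scale unit dot]:
  assumes fin: "finite (arcs L)" and x: "x \<in> supported (generators L)"
    and zero: "P 0" and add: "\<And>x y. P x \<Longrightarrow> P y \<Longrightarrow> P (x + y)"
    and scale: "\<And>r x. P x \<Longrightarrow> P (scale r x)"
    and unit: "\<And>\<alpha>. length \<alpha> = crossings L \<Longrightarrow> P (basis_chain (\<alpha>, unit_labelling L \<alpha>))"
    and dot: "\<And>a x. a \<in> arcs L \<Longrightarrow> x \<in> supported (generators L) \<Longrightarrow> P x \<Longrightarrow> P (dot L a x)"
  shows "P x"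
proof -
  have gen: "P (basis_chain (\<alpha>, v))" if "(\<alpha>, v) \<in> generators L" for \<alpha> v
    using that
  proof (induction "card {c \<in> circles L \<alpha>. v c = LX}" arbitrary: v)
    case 0
    then have "\<forall>c \<in> circles L \<alpha>. v c \<noteq> LX"
      using finite_circles [OF fin] by auto
    then have "\<forall>c \<in> circles L \<alpha>. v c = L1"
      using label.exhaust by metis
    then have "v = unit_labelling L \<alpha>"
      using 0(2) by (auto simp: generators_def unit_labelling_def PiE_iff extensional_def)
    then show ?case using unit 0(2) by (simp add: generators_def)
  next
    case (Suc n)
    have "{c \<in> circles L \<alpha>. v c = LX} \<noteq> {}"
      using Suc(2) by (metis card.empty nat.distinct(1))
    then obtain c where c: "c \<in> circles L \<alpha>" "v c = LX"
      by blast
    obtain a where a: "a \<in> c" using circles_nonempty [OF c(1)] by blast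
    have ac: "a \<in> arcs L" "base_circle L a \<alpha> = c"
      using circles_subset [OF c(1)] a base_circle_eq [OF c(1) a] by auto
    let ?v = "v(c := L1)"
    have "{d \<in> circles L \<alpha>. ?v d = LX} = {d \<in> circles L \<alpha>. v d = LX} - {c}" by auto
    then have "card {d \<in> circles L \<alpha>. ?v d = LX} = n"
      using Suc(2) c finite_circles [OF fin] by simp
    moreover have gv: "(\<alpha>, ?v) \<in> generators L"
      using generators_upd_iff [OF c(1)] Suc.prems by simp
    ultimately have "P (basis_chain (\<alpha>, ?v))" using Suc(1) by blast
    moreover have "basis_chain (\<alpha>, v) = dot L a (basis_chain (\<alpha>, ?v))"
      using fun_upd_triv [of v c] c(2) by (simp add: dot_basis_chain ac)
    ultimately show ?case
      using dot [OF ac(1) basis_chain_supported [OF gv]] by simp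
  qed
  show ?thesis
    by (rule supported_induct [OF finite_generators [OF fin] x zero add scale])
      (use gen in auto)
qed

section \<open>Conjugation and its difference quotient\<close>

definition ones :: "'e diagram \<Rightarrow> bool list \<Rightarrow> ('e set \<Rightarrow> label) \<Rightarrow> 'e set set" where
  "ones L \<alpha> v = {c \<in> circles L \<alpha>. v c = L1}"

definition mark :: "'e set set \<Rightarrow> ('e set \<Rightarrow> label) \<Rightarrow> 'e set \<Rightarrow> label" where
  "mark S v = (\<lambda>c. if c \<in> S then LX else v c)"

text \<open>
  The coefficient at \<open>v\<close> of the image under \<open>x \<mapsto> x + H\<close>: some circles labelled \<open>1\<close> in \<open>v\<close>
  were labelled \<open>x\<close> before, and each of them contributes a factor \<open>H\<close>.
\<close>

definition conj_map :: "'e diagram \<Rightarrow> 'e chain \<Rightarrow> 'e chain" where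
  "conj_map L x = (\<lambda>(\<alpha>, v). \<Sum>S\<in>Pow (ones L \<alpha> v). H_var ^ card S * x (\<alpha>, mark S v))"

text \<open>
  The empty set gives the identity part of \<open>conj_map\<close>; in all other terms one factor \<open>H\<close> can be
  divided out. Writing down the quotient avoids any division of chains by \<open>H\<close>.
\<close>

definition conj_quot :: "'e diagram \<Rightarrow> 'e chain \<Rightarrow> 'e chain" where
  "conj_quot L x =
     (\<lambda>(\<alpha>, v). \<Sum>S\<in>Pow (ones L \<alpha> v) - {{}}. H_var ^ (card S - 1) * x (\<alpha>, mark S v))"

lemma finite_ones: "finite (arcs L) \<Longrightarrow> finite (ones L \<alpha> v)"
  by (simp add: ones_def finite_circles)

lemma mark_empty [simp]: "mark {} v = v"
  by (simp add: mark_def)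

lemma linear_op_conj_quot: "linear_op (conj_quot L)"
  by (auto simp: linear_op_def conj_quot_def fun_eq_iff chain_apply distrib_left sum.distrib
      sum_distrib_left mult.left_commute)

lemma conj_map_eq:
  assumes "finite (arcs L)"
  shows "conj_map L x = x + scale H_var (conj_quot L x)"
proof (rule ext)
  fix g :: "'a generator"
  obtain \<alpha> v where g: "g = (\<alpha>, v)" by force
  let ?f = "\<lambda>S. H_var ^ card S * x (\<alpha>, mark S v)"
  have fin: "finite (ones L \<alpha> v)" using finite_ones [OF assms] .
  have "conj_map L x g = ?f {} + (\<Sum>S\<in>Pow (ones L \<alpha> v) - {{}}. ?f S)"
    unfolding g conj_map_def prod.case
    by (rule sum.remove) (use fin in auto)
  also have "(\<Sum>S\<in>Pow (ones L \<alpha> v) - {{}}. ?f S)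
      = (\<Sum>S\<in>Pow (ones L \<alpha> v) - {{}}. H_var * (H_var ^ (card S - 1) * x (\<alpha>, mark S v)))"
  proof (rule sum.cong [OF refl])
    fix S assume "S \<in> Pow (ones L \<alpha> v) - {{}}"
    then have "card S \<noteq> 0" using fin by (auto dest: finite_subset)
    then have "H_var ^ card S = H_var * H_var ^ (card S - 1)"
      by (simp add: power_eq_if)
    then show "?f S = H_var * (H_var ^ (card S - 1) * x (\<alpha>, mark S v))"
      by (simp add: mult.assoc)
  qed
  finally show "conj_map L x g = (x + scale H_var (conj_quot L x)) g"
    by (simp add: g chain_apply conj_quot_def sum_distrib_left)
qed

lemma sum_Pow_insert:
  fixes f :: "'a set \<Rightarrow> 'b :: comm_monoid_add"
  assumes "finite A" "c \<notin> A"
  shows "(\<Sum>S\<in>Pow (insert c A). f S) = (\<Sum>S\<in>Pow A. f S) + (\<Sum>S\<in>Pow A. f (insert c S))"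
    and "(\<Sum>S\<in>Pow (insert c A) - {{}}. f S)
      = (\<Sum>S\<in>Pow A - {{}}. f S) + (\<Sum>S\<in>Pow A. f (insert c S))"
proof -
  have inj: "inj_on (insert c) (Pow A)"
    using assms(2) by (auto simp: inj_on_def)
  have disj: "Pow A \<inter> insert c ` Pow A = {}" using assms(2) by auto
  show "(\<Sum>S\<in>Pow (insert c A). f S) = (\<Sum>S\<in>Pow A. f S) + (\<Sum>S\<in>Pow A. f (insert c S))"
    unfolding Pow_insert using assms(1) disj
    by (simp add: sum.union_disjoint sum.reindex [OF inj])
  have "Pow (insert c A) - {{}} = (Pow A - {{}}) \<union> insert c ` Pow A"
    unfolding Pow_insert by auto
  moreover have "(Pow A - {{}}) \<inter> insert c ` Pow A = {}" using disj by auto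
  ultimately show "(\<Sum>S\<in>Pow (insert c A) - {{}}. f S)
      = (\<Sum>S\<in>Pow A - {{}}. f S) + (\<Sum>S\<in>Pow A. f (insert c S))"
    using assms(1) by (simp add: sum.union_disjoint sum.reindex [OF inj])
qed

text \<open>
  Conjugation is multiplicative, so \<open>\<sigma> X = (X + H) \<sigma>\<close>; substituting \<open>\<sigma> = 1 + H D\<close> and cancelling
  \<open>H\<close> gives \<open>D X = X D + \<sigma>\<close>. The proof compares coefficients, sorting the subsets \<open>S\<close> by
  whether they contain the circle through \<open>a\<close>.
\<close>

lemma conj_quot_dot:
  assumes fin: "finite (arcs L)" and a: "a \<in> arcs L"
  shows "conj_quot L (dot L a x) = dot L a (conj_quot L x) + conj_map L x"
proof (rule ext)
  fix g :: "'a generator"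
  obtain \<alpha> v where g: "g = (\<alpha>, v)" by force
  define c where "c = base_circle L a \<alpha>"
  have c: "c \<in> circles L \<alpha>" using base_circle_in(1) [OF a] by (simp add: c_def)
  have dot: "dot L a y (\<alpha>, w) =
      (if w c = LX then y (\<alpha>, w(c := L1)) + H_var * y (\<alpha>, w) else 0)" for y w
    by (simp add: dot_def c_def)
  show "conj_quot L (dot L a x) g = (dot L a (conj_quot L x) + conj_map L x) g"
  proof (cases "v c")
    case LX
    let ?A = "ones L \<alpha> v" and ?w = "v(c := L1)"
    have A: "finite ?A" "c \<notin> ?A" using finite_ones [OF fin] LX by (auto simp: ones_def)
    have w: "ones L \<alpha> ?w = insert c ?A" using c by (auto simp: ones_def)
    have cS: "c \<notin> S" if "S \<in> Pow ?A" for S using A(2) that by blast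
    have m1: "(mark S v)(c := L1) = mark S ?w" if "S \<in> Pow ?A" for S
      using cS [OF that] by (auto simp: mark_def)
    have m2: "mark (insert c S) ?w = mark S v" if "S \<in> Pow ?A" for S
      using LX by (auto simp: mark_def)
    have m3: "mark S v c = LX" for S using LX by (simp add: mark_def)
    have cd: "card (insert c S) - 1 = card S" if "S \<in> Pow ?A" for S
      using cS [OF that] finite_subset [OF _ A(1), of S] that by simp
    have "conj_quot L (dot L a x) g =
        (\<Sum>S\<in>Pow ?A - {{}}. H_var ^ (card S - 1) * x (\<alpha>, mark S ?w))
        + H_var * conj_quot L x g"
      unfolding g conj_quot_def prod.case sum_distrib_left sum.distrib [symmetric]
      by (rule sum.cong) (simp_all add: dot m1 m3 algebra_simps)
    also have "(\<Sum>S\<in>Pow ?A - {{}}. H_var ^ (card S - 1) * x (\<alpha>, mark S ?w))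
        = conj_quot L x (\<alpha>, ?w) + conj_map L x g"
    proof -
      have "(\<Sum>S\<in>Pow ?A. H_var ^ (card (insert c S) - 1) * x (\<alpha>, mark (insert c S) ?w))
          = conj_map L x g"
        unfolding g conj_map_def prod.case by (rule sum.cong) (simp_all only: m2 cd)
      then show ?thesis
        unfolding conj_quot_def prod.case w sum_Pow_insert(2) [OF A] by (simp add: add.assoc)
    qed
    finally show ?thesis
      by (simp add: chain_apply g dot LX algebra_simps)
  next
    case L1
    let ?A = "ones L \<alpha> v - {c}"
    have A: "finite ?A" "c \<notin> ?A" using finite_ones [OF fin] by auto
    have v: "ones L \<alpha> v = insert c ?A" using c L1 by (auto simp: ones_def)
    have cS: "c \<notin> S" if "S \<in> Pow ?A" for S using A(2) that by blast
    have m1: "(mark (insert c S) v)(c := L1) = mark S v" if "S \<in> Pow ?A" for S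
      using cS [OF that] L1 by (auto simp: mark_def)
    have m2: "mark S v c = L1" if "S \<in> Pow ?A" for S
      using cS [OF that] L1 by (simp add: mark_def)
    have m3: "mark (insert c S) v c = LX" for S by (simp add: mark_def)
    have cd: "card (insert c S) = Suc (card S)" if "S \<in> Pow ?A" for S
      using cS [OF that] finite_subset [OF _ A(1), of S] that by simp
    have "conj_quot L (dot L a x) g =
        (\<Sum>S\<in>Pow ?A - {{}}. H_var ^ (card S - 1) * dot L a x (\<alpha>, mark S v)) +
        (\<Sum>S\<in>Pow ?A. H_var ^ (card (insert c S) - 1) * dot L a x (\<alpha>, mark (insert c S) v))"
      unfolding g conj_quot_def prod.case by (subst v, rule sum_Pow_insert(2) [OF A])
    also have "\<dots> = (\<Sum>S\<in>Pow ?A.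
        H_var ^ card S * x (\<alpha>, mark S v) + H_var ^ card (insert c S) * x (\<alpha>, mark (insert c S) v))"
    proof -
      have "(\<Sum>S\<in>Pow ?A - {{}}. H_var ^ (card S - 1) * dot L a x (\<alpha>, mark S v)) = 0"
        by (rule sum.neutral) (simp add: dot m2)
      moreover have "(\<Sum>S\<in>Pow ?A. H_var ^ (card (insert c S) - 1) * dot L a x (\<alpha>, mark (insert c S) v))
          = (\<Sum>S\<in>Pow ?A.
        H_var ^ card S * x (\<alpha>, mark S v) + H_var ^ card (insert c S) * x (\<alpha>, mark (insert c S) v))"
        by (rule sum.cong) (simp_all only: dot m1 m3 cd if_True simp_thms diff_Suc_1 distrib_left
            power_Suc mult.assoc mult.left_commute)
      ultimately show ?thesis by simp
    qed
    also have "\<dots> = conj_map L x g"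
      unfolding g conj_map_def prod.case sum.distrib
      by (subst v, rule sum_Pow_insert(1) [OF A, symmetric])
    finally show ?thesis
      by (simp add: chain_apply g dot L1)
  qed
qed

text \<open>Conjugation fixes the unit of the algebra.\<close>

lemma conj_quot_unit: "conj_quot L (basis_chain (\<alpha>, unit_labelling L \<alpha>)) = 0"
proof -
  have "basis_chain (\<alpha>, unit_labelling L \<alpha>) (\<beta>, mark S v) = 0"
    if "S \<in> Pow (ones L \<beta> v) - {{}}" for \<beta> S v
  proof (cases "\<beta> = \<alpha>")
    case True
    from that obtain c where "c \<in> S" "c \<in> circles L \<beta>" by (auto simp: ones_def)
    then have "mark S v c \<noteq> unit_labelling L \<alpha> c"
      using True by (simp add: mark_def unit_labelling_def)
    then show ?thesis by (auto simp: basis_chain_def)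
  qed (simp add: basis_chain_def)
  then show ?thesis
    by (intro ext) (simp add: conj_quot_def chain_apply split_def)
qed

lemma mark_generators_iff:
  assumes "S \<subseteq> circles L \<alpha>"
  shows "(\<alpha>, mark S v) \<in> generators L \<longleftrightarrow> (\<alpha>, v) \<in> generators L"
  using assms by (auto simp: generators_def PiE_iff extensional_def mark_def)

lemma conj_quot_supported:
  assumes "x \<in> supported {g \<in> generators L. P (fst g)}"
  shows "conj_quot L x \<in> supported {g \<in> generators L. P (fst g)}"
proof -
  have "x (\<alpha>, mark S v) = 0"
    if "\<not> ((\<alpha>, v) \<in> generators L \<and> P \<alpha>)" "S \<in> Pow (ones L \<alpha> v) - {{}}" for \<alpha> v S
  proof -
    have "S \<subseteq> circles L \<alpha>" using that(2) by (auto simp: ones_def)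
    then have "(\<alpha>, mark S v) \<notin> {g \<in> generators L. P (fst g)}"
      using that(1) mark_generators_iff [of S L \<alpha> v] by simp
    then show ?thesis using assms unfolding supported_def by blast
  qed
  then show ?thesis
    by (auto simp: supported_def conj_quot_def intro!: sum.neutral)
qed

lemma conj_quot_cong:
  "(\<And>u. x (\<alpha>, u) = y (\<alpha>, u)) \<Longrightarrow> conj_quot L x (\<alpha>, v) = conj_quot L y (\<alpha>, v)"
  by (simp add: conj_quot_def)

text \<open>
  Formally this is \<open>\<sigma>\<^sup>2 = 1\<close>: from \<open>(1 + H D)\<^sup>2 = 1 + H\<^sup>2 D\<^sup>2\<close> in characteristic two. It follows
  more directly from \<open>D\<^sup>2 X = X D\<^sup>2 + H D\<^sup>2\<close> and the fact that the dots generate all chains from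
  the units, which \<open>D\<close> kills.
\<close>

lemma conj_quot_conj_quot:
  assumes fin: "finite (arcs L)" and "x \<in> supported (generators L)"
  shows "conj_quot L (conj_quot L x) = 0"
  using assms
proof (induction rule: dot_induct)
  case (dot a x)
  note lin = linear_op_conj_quot [of L]
  show ?case
    using dot(3)
    by (simp add: conj_quot_dot [OF fin dot(1)] conj_map_eq [OF fin] linear_op_add [OF lin]
        linear_op_scale [OF lin] linear_op_zero [OF linear_op_dot] scale_zero add.assoc)
qed (simp_all add: linear_op_add [OF linear_op_conj_quot] linear_op_scale [OF linear_op_conj_quot]
    linear_op_zero [OF linear_op_conj_quot] conj_quot_unit scale_zero)

section \<open>Edge maps\<close>

definition edge_kernel :: "'e diagram \<Rightarrow> 'e generator \<Rightarrow> 'e generator \<Rightarrow> bit poly" where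
  "edge_kernel L g g' =
     [:edge_coeff mW \<Delta>W L g g':] + H_var * [:edge_coeff mW' \<Delta>W' L g g':]"

lemma bn_diff_eq:
  "bn_diff L x g' = (if g' \<in> generators L
     then \<Sum>g \<in> {g \<in> generators L. cube_edge (fst g) (fst g')}. edge_kernel L g g' * x g else 0)"
  by (simp add: bn_diff_def cube_map_def edge_kernel_def sum.distrib sum_distrib_left
      distrib_right mult.assoc)

lemma linear_op_bn_diff: "linear_op (bn_diff L)"
  by (auto simp: linear_op_def bn_diff_eq fun_eq_iff chain_apply distrib_left sum.distrib
      sum_distrib_left mult.left_commute)

lemma weight_update: "j < length \<alpha> \<Longrightarrow> \<not> \<alpha> ! j \<Longrightarrow> weight (\<alpha>[j := True]) = Suc (weight \<alpha>)"
  unfolding weight_def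
  by (induction \<alpha> arbitrary: j) (auto split: nat.splits simp: nth_Cons)

lemma bn_diff_supported:
  assumes "x \<in> supported {g \<in> generators L. hdeg L g = i}"
  shows "bn_diff L x \<in> supported {g \<in> generators L. hdeg L g = i + 1}"
proof -
  have "edge_kernel L g g' * x g = 0"
    if "g \<in> generators L" "cube_edge (fst g) (fst g')" "hdeg L g' \<noteq> i + 1" for g g'
  proof -
    have "hdeg L g' = hdeg L g + 1"
      using that(2) weight_update by (auto simp: cube_edge_def hdeg_def split: prod.splits)
    then have "x g = 0" using assms that(3) by (cases g) (auto simp: supported_def)
    then show ?thesis by simp
  qed
  then show ?thesis
    by (auto simp: supported_def bn_diff_eq intro!: sum.neutral)
qed

lemma bn_diff_basis_chain:
  assumes "finite (arcs L)" "g \<in> generators L"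
  shows "bn_diff L (basis_chain g) g' =
    (if g' \<in> generators L \<and> cube_edge (fst g) (fst g') then edge_kernel L g g' else 0)"
  using finite_generators [OF assms(1)] assms(2)
  by (auto simp: bn_diff_eq basis_chain_def if_distrib [of "(*) _"] of_bool_def sum.delta cong: if_cong)

lemma merges_unique:
  assumes "merges L \<alpha> \<beta> c1 c2 c" "merges L \<alpha> \<beta> d1 d2 d"
  shows "d = c" "d1 = c1 \<and> d2 = c2 \<or> d1 = c2 \<and> d2 = c1"
  using assms unfolding merges_def by (auto simp: doubleton_eq_iff)

text \<open>A merge removes two circles and creates one, so its reverse is not a merge.\<close>

lemma merges_asym: "merges L \<alpha> \<beta> c1 c2 c \<Longrightarrow> \<not> merges L \<beta> \<alpha> d1 d2 d"
  unfolding merges_def by (metis insertI1 insert_commute singletonD)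

definition agree ::
    "'e diagram \<Rightarrow> bool list \<Rightarrow> bool list \<Rightarrow> ('e set \<Rightarrow> label) \<Rightarrow> ('e set \<Rightarrow> label) \<Rightarrow> bool" where
  "agree L \<alpha> \<beta> v w \<longleftrightarrow> (\<forall>c \<in> circles L \<alpha> \<inter> circles L \<beta>. w c = v c)"

text \<open>
  The existential quantifiers over the circles involved are harmless: only the order of the two
  merged circles is undetermined, and the structure maps do not depend on it.
\<close>

lemma edge_coeff_merge:
  assumes "merges L \<alpha> \<beta> c1 c2 c" and "\<And>k l. \<mu> (k, l) = \<mu> (l, k)"
  shows "edge_coeff \<mu> \<delta> L (\<alpha>, v) (\<beta>, w) = of_bool (agree L \<alpha> \<beta> v w) * \<mu> (v c1, v c2) (w c)"
proof -
  have "(\<exists>d1 d2 d. merges L \<alpha> \<beta> d1 d2 d \<and> \<mu> (v d1, v d2) (w d) = 1) \<longleftrightarrow> \<mu> (v c1, v c2) (w c) = 1"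
    using merges_unique [OF assms(1)] assms by metis
  then show ?thesis
    using merges_asym [OF assms(1)]
    by (cases "\<mu> (v c1, v c2) (w c)") (auto simp: edge_coeff_def agree_def)
qed

lemma edge_coeff_split:
  assumes "merges L \<beta> \<alpha> c1 c2 c" and "\<And>l k k'. \<delta> l (k, k') = \<delta> l (k', k)"
  shows "edge_coeff \<mu> \<delta> L (\<alpha>, v) (\<beta>, w) = of_bool (agree L \<alpha> \<beta> v w) * \<delta> (v c) (w c1, w c2)"
proof -
  have "(\<exists>d1 d2 d. merges L \<beta> \<alpha> d1 d2 d \<and> \<delta> (v d) (w d1, w d2) = 1) \<longleftrightarrow> \<delta> (v c) (w c1, w c2) = 1"
    using merges_unique [OF assms(1)] assms by metis
  then show ?thesis
    using merges_asym [OF assms(1)]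
    by (cases "\<delta> (v c) (w c1, w c2)") (auto simp: edge_coeff_def agree_def)
qed

lemma edge_kernel_other:
  assumes "\<nexists>c1 c2 c. merges L \<alpha> \<beta> c1 c2 c" "\<nexists>c1 c2 c. merges L \<beta> \<alpha> c1 c2 c"
  shows "edge_kernel L (\<alpha>, v) (\<beta>, w) = 0"
  using assms by (simp add: edge_kernel_def edge_coeff_def)

definition merge_kernel :: "label \<times> label \<Rightarrow> label \<Rightarrow> bit poly" where
  "merge_kernel p l = [:mW p l:] + H_var * [:mW' p l:]"

definition split_kernel :: "label \<Rightarrow> label \<times> label \<Rightarrow> bit poly" where
  "split_kernel l p = [:\<Delta>W l p:] + H_var * [:\<Delta>W' l p:]"

lemma merge_kernel_simps [simp]:
  "merge_kernel (L1, L1) l = of_bool (l = L1)"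
  "merge_kernel (L1, LX) l = of_bool (l = LX)"
  "merge_kernel (LX, L1) l = of_bool (l = LX)"
  "merge_kernel (LX, LX) l = H_var * of_bool (l = LX)"
  by (auto simp: merge_kernel_def ket_def zero_fun_apply one_pCons)

lemma split_kernel_simps [simp]:
  "split_kernel L1 (k, l) = (if k = L1 then if l = L1 then H_var else 1 else of_bool (l = L1))"
  "split_kernel LX (k, l) = of_bool (k = LX \<and> l = LX)"
  by (cases k; cases l; simp add: split_kernel_def ket_def chain_apply one_pCons)+

lemma mW_commute: "mW (k, l) = mW (l, k)" "mW' (k, l) = mW' (l, k)"
  by (cases k; cases l; simp)+

lemma \<Delta>W_commute: "\<Delta>W l (k, k') = \<Delta>W l (k', k)" "\<Delta>W' l (k, k') = \<Delta>W' l (k', k)"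
  by (cases l; cases k; cases k'; simp add: ket_def chain_apply)+

lemma edge_kernel_merge:
  assumes "merges L \<alpha> \<beta> c1 c2 c"
  shows "edge_kernel L (\<alpha>, v) (\<beta>, w) =
    of_bool (agree L \<alpha> \<beta> v w) * merge_kernel (v c1, v c2) (w c)"
  using edge_coeff_merge [OF assms, of mW] edge_coeff_merge [OF assms, of mW'] mW_commute
  by (simp add: edge_kernel_def merge_kernel_def)

lemma edge_kernel_split:
  assumes "merges L \<beta> \<alpha> c1 c2 c"
  shows "edge_kernel L (\<alpha>, v) (\<beta>, w) =
    of_bool (agree L \<alpha> \<beta> v w) * split_kernel (v c) (w c1, w c2)"
  using edge_coeff_split [OF assms, of \<Delta>W] edge_coeff_split [OF assms, of \<Delta>W'] \<Delta>W_commute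
  by (simp add: edge_kernel_def split_kernel_def)

section \<open>The operators commute with the differential\<close>

lemma merges_circles:
  assumes "merges L \<alpha> \<beta> c1 c2 c"
  shows "c1 \<noteq> c2" "c1 \<in> circles L \<alpha>" "c2 \<in> circles L \<alpha>" "c \<in> circles L \<beta>"
    "c1 \<notin> circles L \<beta>" "c2 \<notin> circles L \<beta>" "c \<notin> circles L \<alpha>"
    "\<And>e. e \<in> circles L \<alpha> \<Longrightarrow> e = c1 \<or> e = c2 \<or> e \<in> circles L \<beta>"
    "\<And>e. e \<in> circles L \<beta> \<Longrightarrow> e = c \<or> e \<in> circles L \<alpha>"
  using assms unfolding merges_def by blast+

lemma agree_fun_upd:
  assumes "e \<in> circles L \<alpha>" "e \<in> circles L \<beta>"
  shows "agree L \<alpha> \<beta> v w \<longleftrightarrow> w e = v e \<and> (\<forall>c \<in> circles L \<alpha> \<inter> circles L \<beta> - {e}. w c = v c)"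
  using assms unfolding agree_def by blast

lemma agree_upd_source: "e \<notin> circles L \<beta> \<Longrightarrow> agree L \<alpha> \<beta> (v(e := l)) w = agree L \<alpha> \<beta> v w"
  and agree_upd_target: "e \<notin> circles L \<alpha> \<Longrightarrow> agree L \<alpha> \<beta> v (w(e := l)) = agree L \<alpha> \<beta> v w"
  unfolding agree_def by auto

text \<open>
  Both resolutions partition the same set of arcs, so an arc lies on a circle affected by the
  merge before if and only if it does so afterwards.
\<close>

lemma base_circle_merge:
  assumes m: "merges L \<alpha> \<beta> c1 c2 c" and a: "a \<in> arcs L"
    and e: "base_circle L a \<alpha> \<notin> circles L \<beta>"
  shows "base_circle L a \<alpha> = c1 \<or> base_circle L a \<alpha> = c2" "base_circle L a \<beta> = c"
proof -
  show "base_circle L a \<alpha> = c1 \<or> base_circle L a \<alpha> = c2"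
    using merges_circles(8) [OF m base_circle_in(1) [OF a]] e by blast
  have "base_circle L a \<beta> \<notin> circles L \<alpha>"
    using base_circle_common [OF a, of \<beta> \<alpha>] base_circle_in(1) [OF a, of \<beta>] e by auto
  then show "base_circle L a \<beta> = c"
    using merges_circles(9) [OF m base_circle_in(1) [OF a]] by blast
qed

text \<open>
  Multiplication by \<open>x\<close> at an arc before (left) and after (right) an edge map, compared entry by
  entry. If the circle of the arc is not involved, both sides multiply by \<open>x\<close> on the same
  untouched tensor factor. Otherwise the identity says that multiplication and
  comultiplication of \<open>A\<close> are \<open>A\<close>-linear.
\<close>

lemma edge_kernel_dot:
  assumes a: "a \<in> arcs L"
    and e_def: "e = base_circle L a \<alpha>" and f_def: "f = base_circle L a \<beta>"
  shows "(if v e = L1 then edge_kernel L (\<alpha>, v(e := LX)) (\<beta>, w)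
        else H_var * edge_kernel L (\<alpha>, v) (\<beta>, w))
    = (if w f = LX then edge_kernel L (\<alpha>, v) (\<beta>, w(f := L1))
        + H_var * edge_kernel L (\<alpha>, v) (\<beta>, w) else 0)" (is "?l = ?r")
proof -
  have e: "e \<in> circles L \<alpha>" "f \<in> circles L \<beta>"
    using base_circle_in(1) [OF a] by (simp_all add: e_def f_def)
  consider
      (other) "\<nexists>c1 c2 c. merges L \<alpha> \<beta> c1 c2 c" "\<nexists>c1 c2 c. merges L \<beta> \<alpha> c1 c2 c"
    | (merge) c1 c2 c where "merges L \<alpha> \<beta> c1 c2 c"
    | (split) c1 c2 c where "merges L \<beta> \<alpha> c1 c2 c"
    by blast
  then show ?thesis
  proof cases
    case other
    then show ?thesis by (simp add: edge_kernel_other)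
  next
    case merge
    note ker = edge_kernel_merge [OF merge] and circ = merges_circles [OF merge]
    show ?thesis
    proof (cases "e \<in> circles L \<beta>")
      case True
      then have f: "f = e" using base_circle_common [OF a] by (simp add: e_def f_def)
      have ne: "e \<noteq> c1" "e \<noteq> c2" "e \<noteq> c" using True e(1) circ by auto
      show ?thesis
        unfolding ker f agree_fun_upd [OF e(1) True] using ne
        by (cases "v e"; cases "w e") simp_all
    next
      case False
      then have f: "f = c" and e': "e = c1 \<or> e = c2"
        using base_circle_merge [OF merge a] by (simp_all add: e_def f_def)
      show ?thesis
        using e' unfolding ker f
        by (cases "v c1"; cases "v c2"; cases "w c")
          (auto simp: agree_upd_source agree_upd_target circ circ(1) [symmetric])
    qed
  next
    case split
    note ker = edge_kernel_split [OF split] and circ = merges_circles [OF split]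
    show ?thesis
    proof (cases "f \<in> circles L \<alpha>")
      case True
      then have f: "e = f" using base_circle_common [OF a] by (simp add: e_def f_def)
      have ne: "f \<noteq> c1" "f \<noteq> c2" "f \<noteq> c" using True e(2) circ by auto
      show ?thesis
        unfolding ker f agree_fun_upd [OF True e(2)] using ne
        by (cases "v f"; cases "w f") simp_all
    next
      case False
      then have f: "e = c" and e': "f = c1 \<or> f = c2"
        using base_circle_merge [OF split a] by (simp_all add: e_def f_def)
      show ?thesis
        using e' unfolding ker f
        by (cases "w c1"; cases "w c2"; cases "v c")
          (auto simp: agree_upd_source agree_upd_target circ circ(1) [symmetric])
    qed
  qed
qed

lemma dot_bn_diff:
  assumes fin: "finite (arcs L)" and a: "a \<in> arcs L" and x: "x \<in> supported (generators L)"
  shows "dot L a (bn_diff L x) = bn_diff L (dot L a x)"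
proof (rule linear_op_eqI [OF finite_generators [OF fin] x])
  show "linear_op (\<lambda>x. dot L a (bn_diff L x))"
    by (rule linear_op_comp [OF linear_op_dot linear_op_bn_diff])
  show "linear_op (\<lambda>x. bn_diff L (dot L a x))"
    by (rule linear_op_comp [OF linear_op_bn_diff linear_op_dot])
next
  fix g assume "g \<in> generators L"
  obtain \<alpha> v where g: "g = (\<alpha>, v)" by force
  then have gen: "(\<alpha>, v) \<in> generators L" using \<open>g \<in> generators L\<close> by simp
  let ?e = "base_circle L a \<alpha>"
  have gen': "(\<alpha>, v(?e := LX)) \<in> generators L"
    using gen generators_upd_iff [OF base_circle_in(1) [OF a]] by simp
  show "dot L a (bn_diff L (basis_chain g)) = bn_diff L (dot L a (basis_chain g))"
  proof (rule ext)
    fix g' :: "'a generator"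
    obtain \<beta> w where g': "g' = (\<beta>, w)" by force
    let ?f = "base_circle L a \<beta>"
    have iff: "(\<beta>, w(?f := L1)) \<in> generators L \<longleftrightarrow> (\<beta>, w) \<in> generators L"
      using generators_upd_iff [OF base_circle_in(1) [OF a]] .
    have l: "dot L a (bn_diff L (basis_chain g)) g' =
      (if (\<beta>, w) \<in> generators L \<and> cube_edge \<alpha> \<beta> then
        (if w ?f = LX then edge_kernel L (\<alpha>, v) (\<beta>, w(?f := L1))
          + H_var * edge_kernel L (\<alpha>, v) (\<beta>, w) else 0) else 0)"
      unfolding g g' dot_def prod.case bn_diff_basis_chain [OF fin gen] iff by simp
    have r: "bn_diff L (dot L a (basis_chain g)) g' =
      (if (\<beta>, w) \<in> generators L \<and> cube_edge \<alpha> \<beta> then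
        (if v ?e = L1 then edge_kernel L (\<alpha>, v(?e := LX)) (\<beta>, w)
          else H_var * edge_kernel L (\<alpha>, v) (\<beta>, w)) else 0)"
      unfolding g g' dot_basis_chain
      by (simp add: linear_op_scale [OF linear_op_bn_diff] bn_diff_basis_chain [OF fin gen]
          bn_diff_basis_chain [OF fin gen'] scale_apply)
    show "dot L a (bn_diff L (basis_chain g)) g' = bn_diff L (dot L a (basis_chain g)) g'"
      unfolding l r edge_kernel_dot [OF a refl refl] ..
  qed
qed

lemma generator_eqI:
  assumes "(\<beta>, w) \<in> generators L" "(\<beta>, w') \<in> generators L"
    and "\<And>c. c \<in> circles L \<beta> \<Longrightarrow> w c = w' c"
  shows "w = w'"
  using assms by (auto simp: generators_def intro: PiE_ext)

text \<open>
  On the unit of the algebra a merge gives the unit, which \<open>D\<close> kills. A split gives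
  \<open>\<Delta>(1) = (X\<^sub>a + X\<^sub>b + H) 1\<close> for arcs \<open>a\<close>, \<open>b\<close> on the two new circles, and
  \<open>D X\<^sub>a 1 = 1 = D X\<^sub>b 1\<close>, so the two contributions cancel.
\<close>

lemma conj_quot_bn_diff_unit:
  assumes fin: "finite (arcs L)" and len: "length \<alpha> = crossings L"
  shows "conj_quot L (bn_diff L (basis_chain (\<alpha>, unit_labelling L \<alpha>))) = 0"
proof (rule ext)
  fix g :: "'a generator"
  obtain \<beta> w where g: "g = (\<beta>, w)" by force
  let ?u = "unit_labelling L \<alpha>" and ?u' = "unit_labelling L \<beta>"
  let ?y = "bn_diff L (basis_chain (\<alpha>, ?u))" and ?b = "basis_chain (\<beta>, ?u')"
  have gen: "(\<alpha>, ?u) \<in> generators L" using len by (simp add: unit_labelling_generator)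
  have y: "?y (\<beta>, w) = (if (\<beta>, w) \<in> generators L \<and> cube_edge \<alpha> \<beta>
      then edge_kernel L (\<alpha>, ?u) (\<beta>, w) else 0)" for w
    by (simp add: bn_diff_basis_chain [OF fin gen])
  \<comment> \<open>\<open>D\<close> acts on each vertex of the cube separately, so it is enough to know the image over \<open>\<beta>\<close>.\<close>
  have "\<exists>z. conj_quot L z = 0 \<and> (\<forall>w. ?y (\<beta>, w) = z (\<beta>, w))"
  proof (cases "length \<beta> = crossings L \<and> cube_edge \<alpha> \<beta>")
    case False
    then have "?y (\<beta>, w) = 0" for w by (auto simp: y generators_def)
    then show ?thesis
      by (intro exI [of _ 0]) (simp add: linear_op_zero [OF linear_op_conj_quot] chain_apply)
  next
    case True
    then have gen': "(\<beta>, ?u') \<in> generators L" by (simp add: unit_labelling_generator)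
    consider
        (other) "\<nexists>c1 c2 c. merges L \<alpha> \<beta> c1 c2 c" "\<nexists>c1 c2 c. merges L \<beta> \<alpha> c1 c2 c"
      | (merge) c1 c2 c where "merges L \<alpha> \<beta> c1 c2 c"
      | (split) c1 c2 c where "merges L \<beta> \<alpha> c1 c2 c"
      by blast
    then show ?thesis
    proof cases
      case other
      then have "?y (\<beta>, w) = 0" for w by (simp add: y edge_kernel_other)
      then show ?thesis
        by (intro exI [of _ 0]) (simp add: linear_op_zero [OF linear_op_conj_quot] chain_apply)
    next
      case merge
      note circ = merges_circles [OF merge]
      have "?y (\<beta>, w) = ?b (\<beta>, w)" for w
      proof (cases "(\<beta>, w) \<in> generators L")
        case True
        have "agree L \<alpha> \<beta> ?u w \<and> w c = L1 \<longleftrightarrow> (\<forall>d \<in> circles L \<beta>. w d = L1)"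
          using circ(4,7,9) by (auto simp: agree_def unit_labelling_def)
        also have "\<dots> \<longleftrightarrow> w = ?u'"
          using generator_eqI [OF True gen'] by (auto simp: unit_labelling_def)
        finally have iff: "agree L \<alpha> \<beta> ?u w \<and> w c = L1 \<longleftrightarrow> w = ?u'" .
        have "?u c1 = L1" "?u c2 = L1" using circ by (simp_all add: unit_labelling_def)
        then have "?y (\<beta>, w) = of_bool (agree L \<alpha> \<beta> ?u w) * of_bool (w c = L1)"
          using True \<open>length \<beta> = crossings L \<and> cube_edge \<alpha> \<beta>\<close>
          by (simp add: y edge_kernel_merge [OF merge])
        also have "\<dots> = of_bool (w = ?u')" by (simp flip: iff)
        finally show ?thesis by (simp add: basis_chain_def)
      next
        case False
        then have "w \<noteq> ?u'" using gen' by blast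
        then have "?b (\<beta>, w) = 0" by (simp add: basis_chain_def)
        then show ?thesis using False by (simp add: y)
      qed
      then show ?thesis using conj_quot_unit by metis
    next
      case split
      note circ = merges_circles [OF split]
      obtain a1 a2 where a: "a1 \<in> c1" "a2 \<in> c2"
        using circles_nonempty [OF circ(2)] circles_nonempty [OF circ(3)] by blast
      have arcs: "a1 \<in> arcs L" "a2 \<in> arcs L"
        using a circles_subset [OF circ(2)] circles_subset [OF circ(3)] by auto
      have base: "base_circle L a1 \<beta> = c1" "base_circle L a2 \<beta> = c2"
        by (fact base_circle_eq [OF circ(2) a(1)], fact base_circle_eq [OF circ(3) a(2)])
      let ?z = "dot L a1 ?b + (dot L a2 ?b + scale H_var ?b)"
      have "conj_quot L ?z = ?b + ?b"
        by (simp add: linear_op_add [OF linear_op_conj_quot] linear_op_scale [OF linear_op_conj_quot]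
            conj_quot_dot [OF fin] arcs conj_map_eq [OF fin] conj_quot_unit
            linear_op_zero [OF linear_op_dot] scale_zero)
      then have "conj_quot L ?z = 0" by simp
      moreover have "?y (\<beta>, w) = ?z (\<beta>, w)" for w
      proof (cases "(\<beta>, w) \<in> generators L")
        case True
        have u1: "?u' c1 = L1" "?u' c2 = L1" using circ by (simp_all add: unit_labelling_def)
        have z: "?z = basis_chain (\<beta>, ?u'(c1 := LX)) + (basis_chain (\<beta>, ?u'(c2 := LX))
            + scale H_var ?b)"
          by (simp add: dot_basis_chain base u1)
        have eq: "w = ?u'(c1 := k, c2 := l) \<longleftrightarrow> agree L \<alpha> \<beta> ?u w \<and> w c1 = k \<and> w c2 = l" for k l
        proof -
          have "(\<beta>, ?u'(c1 := k, c2 := l)) \<in> generators L"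
            using gen' generators_upd_iff circ(2,3) by metis
          then have "w = ?u'(c1 := k, c2 := l) \<longleftrightarrow>
              (\<forall>d \<in> circles L \<beta>. w d = (?u'(c1 := k, c2 := l)) d)"
            using generator_eqI [OF True] by blast
          also have "\<dots> \<longleftrightarrow> agree L \<alpha> \<beta> ?u w \<and> w c1 = k \<and> w c2 = l"
            using circ by (auto simp: agree_def unit_labelling_def)
          finally show ?thesis .
        qed
        have eqs: "w = ?u'(c1 := LX) \<longleftrightarrow> agree L \<alpha> \<beta> ?u w \<and> w c1 = LX \<and> w c2 = L1"
          "w = ?u'(c2 := LX) \<longleftrightarrow> agree L \<alpha> \<beta> ?u w \<and> w c1 = L1 \<and> w c2 = LX"
          "w = ?u' \<longleftrightarrow> agree L \<alpha> \<beta> ?u w \<and> w c1 = L1 \<and> w c2 = L1"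
          using eq [of LX L1] eq [of L1 LX] eq [of L1 L1] fun_upd_triv [of ?u'] u1 circ(1)
          by (metis fun_upd_twist)+
        have uc: "?u c = L1" using circ by (simp add: unit_labelling_def)
        have "?y (\<beta>, w) = of_bool (agree L \<alpha> \<beta> ?u w) * split_kernel L1 (w c1, w c2)"
          using True \<open>length \<beta> = crossings L \<and> cube_edge \<alpha> \<beta>\<close>
          by (simp add: y edge_kernel_split [OF split] uc)
        also have "\<dots> = ?z (\<beta>, w)"
          unfolding z by (cases "w c1"; cases "w c2")
            (simp_all add: chain_apply basis_chain_def eqs)
        finally show ?thesis .
      next
        case False
        have "?z \<in> supported (generators L)"
          using gen' by (intro supported_add supported_scale dot_supported_generators arcs
              basis_chain_supported)
        then show ?thesis using False by (simp add: y supported_def)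
      qed
      ultimately show ?thesis by blast
    qed
  qed
  then obtain z where "conj_quot L z = 0" "\<And>w. ?y (\<beta>, w) = z (\<beta>, w)" by blast
  then show "conj_quot L ?y g = 0 g"
    using conj_quot_cong [of ?y \<beta> z L w] by (simp add: g)
qed

text \<open>
  If \<open>D d x = d D x\<close>, then also \<open>D d X x = D X d x = (X D + 1 + H D) d x = d (X D + 1 + H D) x =
  d D X x\<close>; thus the relation passes from the units to all chains.
\<close>

lemma conj_quot_bn_diff:
  assumes fin: "finite (arcs L)" and "x \<in> supported (generators L)"
  shows "conj_quot L (bn_diff L x) = bn_diff L (conj_quot L x)"
  using assms
proof (induction rule: dot_induct)
  case zero
  then show ?case
    by (simp add: linear_op_zero [OF linear_op_conj_quot] linear_op_zero [OF linear_op_bn_diff])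
next
  case (add x y)
  then show ?case
    by (simp add: linear_op_add [OF linear_op_conj_quot] linear_op_add [OF linear_op_bn_diff])
next
  case (scale r x)
  then show ?case
    by (simp add: linear_op_scale [OF linear_op_conj_quot] linear_op_scale [OF linear_op_bn_diff])
next
  case (unit \<alpha>)
  then show ?case
    by (simp add: conj_quot_unit conj_quot_bn_diff_unit [OF fin] linear_op_zero [OF linear_op_bn_diff])
next
  case (dot a x)
  have "conj_quot L x \<in> supported (generators L)"
    using conj_quot_supported [of x L "\<lambda>_. True"] dot(2) by simp
  then have "dot L a (bn_diff L (conj_quot L x)) = bn_diff L (dot L a (conj_quot L x))"
    by (rule dot_bn_diff [OF fin dot(1)])
  then show ?case
    using dot(3)
    by (simp add: dot_bn_diff [OF fin dot(1,2), symmetric] conj_quot_dot [OF fin dot(1)]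
        conj_map_eq [OF fin] linear_op_add [OF linear_op_bn_diff]
        linear_op_scale [OF linear_op_bn_diff])
qed

section \<open>Quantum degrees\<close>

definition homogeneous :: "'e diagram \<Rightarrow> int \<Rightarrow> 'e chain \<Rightarrow> bool" where
  "homogeneous L q x \<longleftrightarrow> (\<forall>g k. poly.coeff (x g) k \<noteq> 0 \<longrightarrow> qdeg L g - 2 * int k = q)"

lemma coeff_H_power: "poly.coeff (H_var ^ m * p) k = (if k < m then 0 else poly.coeff p (k - m))"
proof -
  have "H_var ^ m = monom 1 m"
    by (simp add: H_var_def monom_altdef)
  then show ?thesis by (simp add: coeff_monom_mult)
qed

lemma homogeneous_add:
  assumes "homogeneous L q x" "homogeneous L q y"
  shows "homogeneous L q (x + y)"
proof -
  have "poly.coeff (x g) k \<noteq> 0 \<or> poly.coeff (y g) k \<noteq> 0"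
    if "poly.coeff ((x + y) g) k \<noteq> 0" for g k
    using that by (auto simp: chain_apply)
  then show ?thesis using assms unfolding homogeneous_def by blast
qed

lemma homogeneous_scale_H:
  assumes "homogeneous L (q + 2) x"
  shows "homogeneous L q (scale H_var x)"
  unfolding homogeneous_def
proof (intro allI impI)
  fix g k assume k: "poly.coeff (scale H_var x g) k \<noteq> 0"
  then have "k \<ge> 1" "poly.coeff (x g) (k - 1) \<noteq> 0"
    using coeff_H_power [of 1 "x g" k] by (auto simp: scale_apply split: if_splits)
  moreover from this have "qdeg L g - 2 * int (k - 1) = q + 2"
    using assms unfolding homogeneous_def by blast
  ultimately show "qdeg L g - 2 * int k = q"
    by (simp add: of_nat_diff)
qed

lemma qdeg_mark:
  assumes fin: "finite (arcs L)" and S: "S \<subseteq> ones L \<alpha> v"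
  shows "qdeg L (\<alpha>, mark S v) = qdeg L (\<alpha>, v) - 2 * int (card S)"
proof -
  let ?X = "{c \<in> circles L \<alpha>. v c = LX}"
  have finS: "finite S" using finite_subset [OF S finite_ones [OF fin]] .
  have "{c \<in> circles L \<alpha>. mark S v c = L1} = ones L \<alpha> v - S"
    by (auto simp: mark_def ones_def)
  moreover have "{c \<in> circles L \<alpha>. mark S v c = LX} = ?X \<union> S"
    using S by (auto simp: mark_def ones_def)
  moreover have "card (?X \<union> S) = card ?X + card S"
    using S finite_circles [OF fin] finS by (intro card_Un_disjoint) (auto simp: ones_def)
  moreover have "int (card (ones L \<alpha> v - S)) = int (card (ones L \<alpha> v)) - int (card S)"
    using S finS card_mono [OF finite_ones [OF fin] S] by (simp add: card_Diff_subset of_nat_diff)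
  ultimately show ?thesis
    by (simp add: qdeg_def gr_def hdeg_def ones_def)
qed

lemma homogeneous_dot:
  assumes fin: "finite (arcs L)" and a: "a \<in> arcs L" and x: "homogeneous L (q + 2) x"
  shows "homogeneous L q (dot L a x)"
  unfolding homogeneous_def
proof (intro allI impI)
  fix g k assume k: "poly.coeff (dot L a x g) k \<noteq> 0"
  obtain \<alpha> v where g: "g = (\<alpha>, v)" by force
  let ?c = "base_circle L a \<alpha>" and ?w = "v(base_circle L a \<alpha> := L1)"
  have c: "?c \<in> circles L \<alpha>" using base_circle_in(1) [OF a] .
  have v: "v ?c = LX" using k by (auto simp: g dot_def split: if_splits)
  have "mark {?c} ?w = v" using v by (auto simp: mark_def)
  then have q: "qdeg L g = qdeg L (\<alpha>, ?w) - 2"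
    using qdeg_mark [OF fin, of "{?c}" \<alpha> ?w] c by (simp add: g ones_def)
  have "poly.coeff (x (\<alpha>, ?w)) k \<noteq> 0 \<or> poly.coeff (scale H_var x g) k \<noteq> 0"
    using k v by (auto simp: g dot_def scale_apply)
  then show "qdeg L g - 2 * int k = q"
  proof
    assume "poly.coeff (x (\<alpha>, ?w)) k \<noteq> 0"
    then have "qdeg L (\<alpha>, ?w) - 2 * int k = q + 2"
      using x unfolding homogeneous_def by blast
    then show ?thesis using q by simp
  next
    assume "poly.coeff (scale H_var x g) k \<noteq> 0"
    then show ?thesis using homogeneous_scale_H [OF x] unfolding homogeneous_def by blast
  qed
qed

lemma homogeneous_conj_quot:
  assumes fin: "finite (arcs L)" and x: "homogeneous L q x"
  shows "homogeneous L (q + 2) (conj_quot L x)"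
  unfolding homogeneous_def
proof (intro allI impI)
  fix g k assume k: "poly.coeff (conj_quot L x g) k \<noteq> 0"
  obtain \<alpha> v where g: "g = (\<alpha>, v)" by force
  obtain S where S: "S \<in> Pow (ones L \<alpha> v) - {{}}"
    and nz: "poly.coeff (H_var ^ (card S - 1) * x (\<alpha>, mark S v)) k \<noteq> 0"
    using k unfolding g conj_quot_def prod.case coeff_sum by (rule sum.not_neutral_contains_not_neutral)
  have "card S \<noteq> 0"
    using S finite_subset [OF _ finite_ones [OF fin], of S] by auto
  moreover have "k \<ge> card S - 1" "poly.coeff (x (\<alpha>, mark S v)) (k - (card S - 1)) \<noteq> 0"
    using nz by (auto simp: coeff_H_power split: if_splits)
  moreover have "qdeg L (\<alpha>, mark S v) = qdeg L g - 2 * int (card S)"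
    using qdeg_mark [OF fin] S by (simp add: g)
  moreover have "qdeg L (\<alpha>, mark S v) - 2 * int (k - (card S - 1)) = q"
    using x calculation(3) unfolding homogeneous_def by blast
  ultimately show "qdeg L g - 2 * int k = q + 2"
    by (simp add: of_nat_diff)
qed


section \<open>Free modules of chains\<close>

lemma free_module_sel:
  "carrier (free_module S) = supported S"
  "\<zero>\<^bsub>free_module S\<^esub> = 0"
  "x \<oplus>\<^bsub>free_module S\<^esub> y = x + y"
  "r \<odot>\<^bsub>free_module S\<^esub> x = scale r x"
  by (simp_all add: free_module_def supported_def zero_fun_def plus_fun_def scale_def)

lemma cring_F2H: "cring F2H"
proof (rule cringI)
  show "abelian_group F2H"
  proof (rule abelian_groupI)
    fix x assume "x \<in> carrier F2H"
    show "\<exists>y\<in>carrier F2H. y \<oplus>\<^bsub>F2H\<^esub> x = \<zero>\<^bsub>F2H\<^esub>"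
      by (intro bexI [of _ x]) (simp_all add: F2H_def)
  qed (simp_all add: F2H_def algebra_simps)
  show "Group.comm_monoid F2H"
    by (intro comm_monoidI) (simp_all add: F2H_def algebra_simps)
qed (simp add: F2H_def algebra_simps)

lemma module_free_module: "Module.module F2H (free_module S :: (bit poly, 'e chain) module)"
proof (rule moduleI [OF cring_F2H])
  show "abelian_group (free_module S :: (bit poly, 'e chain) module)"
  proof (rule abelian_groupI)
    fix x :: "'e chain" assume "x \<in> carrier (free_module S)"
    then show "\<exists>y\<in>carrier (free_module S). y \<oplus>\<^bsub>free_module S\<^esub> x = \<zero>\<^bsub>free_module S\<^esub>"
      by (intro bexI [of _ x]) (simp_all add: free_module_sel)
  qed (simp_all add: free_module_sel supported_add supported_zero add.assoc add.commute)
qed (simp_all add: free_module_sel supported_scale F2H_def scale_add scale_scale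
    fun_eq_iff chain_apply distrib_right)


section \<open>Homology of isomorphic complexes\<close>

lemma a_r_coset_image: "B +>\<^bsub>M\<^esub> z = (\<lambda>h. h \<oplus>\<^bsub>M\<^esub> z) ` B"
  by (auto simp: a_r_coset_def')

lemma quotient_module_sel:
  "carrier (quotient_module (M\<lparr>carrier := Z\<rparr>) B) = (\<lambda>z. (\<lambda>h. h \<oplus>\<^bsub>M\<^esub> z) ` B) ` Z"
  "A \<oplus>\<^bsub>quotient_module (M\<lparr>carrier := Z\<rparr>) B\<^esub> A' = (\<Union>a\<in>A. \<Union>a'\<in>A'. {a \<oplus>\<^bsub>M\<^esub> a'})"
  "r \<odot>\<^bsub>quotient_module (M\<lparr>carrier := Z\<rparr>) B\<^esub> A = (\<Union>a\<in>A. (\<lambda>h. h \<oplus>\<^bsub>M\<^esub> (r \<odot>\<^bsub>M\<^esub> a)) ` B)"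
  by (auto simp: quotient_module_def A_RCOSETS_def' set_add_def' a_r_coset_image)

lemma module_isoI:
  assumes "bij_betw f (carrier M) (carrier N)"
    and "\<And>x y. x \<in> carrier M \<Longrightarrow> y \<in> carrier M \<Longrightarrow> f (x \<oplus>\<^bsub>M\<^esub> y) = f x \<oplus>\<^bsub>N\<^esub> f y"
    and "\<And>r x. r \<in> carrier R \<Longrightarrow> x \<in> carrier M \<Longrightarrow> f (r \<odot>\<^bsub>M\<^esub> x) = r \<odot>\<^bsub>N\<^esub> f x"
  shows "f \<in> module_iso R M N"
  using assms bij_betw_imp_funcset [OF assms(1)] by (simp add: module_iso_def iso_def hom_def)

lemma module_isoD:
  assumes "f \<in> module_iso R M N"
  shows "bij_betw f (carrier M) (carrier N)"
    and "\<And>x y. x \<in> carrier M \<Longrightarrow> y \<in> carrier M \<Longrightarrow> f (x \<oplus>\<^bsub>M\<^esub> y) = f x \<oplus>\<^bsub>N\<^esub> f y"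
    and "\<And>r x. r \<in> carrier R \<Longrightarrow> x \<in> carrier M \<Longrightarrow> f (r \<odot>\<^bsub>M\<^esub> x) = r \<odot>\<^bsub>N\<^esub> f x"
  using assms by (simp_all add: module_iso_def iso_def hom_def)

lemma module_iso_zero:
  assumes "f \<in> module_iso R M N" "abelian_group M" "abelian_group N"
  shows "f \<zero>\<^bsub>M\<^esub> = \<zero>\<^bsub>N\<^esub>"
proof -
  interpret M: abelian_group M by fact
  interpret N: abelian_group N by fact
  have "f \<in> hom (add_monoid M) (add_monoid N)"
    using assms(1) by (simp add: module_iso_def iso_def)
  then show ?thesis
    using hom_one [of f "add_monoid M" "add_monoid N"] M.a_group N.a_group by simp
qed

lemma modules_isomorphic_trans:
  assumes "modules_isomorphic R M N" "modules_isomorphic R N P"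
  shows "modules_isomorphic R M P"
proof -
  obtain f g where f: "f \<in> module_iso R M N" and g: "g \<in> module_iso R N P"
    using assms by (auto simp: modules_isomorphic_def)
  have "f x \<in> carrier N" if "x \<in> carrier M" for x
    using bij_betwE [OF module_isoD(1) [OF f]] that by blast
  then have "g \<circ> f \<in> module_iso R M P"
    using module_isoD [OF f] module_isoD [OF g]
    by (intro module_isoI bij_betw_trans [of f "carrier M" "carrier N" g]) simp_all
  then show ?thesis by (auto simp: modules_isomorphic_def)
qed

text \<open>
  The cosets that make up the quotient are formed with the addition of the ambient module, so
  taking images under an isomorphism of the ambient modules carries one quotient to the other.
\<close>

lemma quotient_module_transport:
  assumes M: "Module.module R M" and f: "f \<in> module_iso R M N"
    and Z: "Z \<subseteq> carrier M" and B: "B \<subseteq> carrier M"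
  shows "modules_isomorphic R (quotient_module (M\<lparr>carrier := Z\<rparr>) B)
    (quotient_module (N\<lparr>carrier := f ` Z\<rparr>) (f ` B))" (is "modules_isomorphic R ?Q ?Q'")
proof -
  interpret Module.module R M by fact
  note bij = module_isoD(1) [OF f] and add = module_isoD(2) [OF f] and smult = module_isoD(3) [OF f]
  have coset: "(\<lambda>h. f h \<oplus>\<^bsub>N\<^esub> f z) ` B = (\<lambda>h. f (h \<oplus>\<^bsub>M\<^esub> z)) ` B" if "z \<in> carrier M" for z
    using that B by (intro image_cong) (auto simp: add)
  have sub: "A \<subseteq> carrier M" if "A \<in> carrier ?Q" for A
    using that Z B by (auto simp: quotient_module_sel)
  have "(\<lambda>A. f ` A) \<in> module_iso R ?Q ?Q'"
  proof (rule module_isoI)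
    have "inj_on (\<lambda>A. f ` A) (carrier ?Q)"
      using bij_betw_imp_inj_on [OF bij] sub
      by (intro inj_onI) (simp add: inj_on_image_eq_iff)
    moreover have "(\<lambda>A. f ` A) ` carrier ?Q = carrier ?Q'"
      unfolding quotient_module_sel image_image
      by (rule image_cong [OF refl], rule coset [symmetric]) (use Z in auto)
    ultimately show "bij_betw (\<lambda>A. f ` A) (carrier ?Q) (carrier ?Q')"
      by (simp add: bij_betw_def)
  next
    fix A A' assume "A \<in> carrier ?Q" "A' \<in> carrier ?Q"
    then have "f (a \<oplus>\<^bsub>M\<^esub> a') = f a \<oplus>\<^bsub>N\<^esub> f a'" if "a \<in> A" "a' \<in> A'" for a a'
      using sub that by (intro add) blast+
    then show "f ` (A \<oplus>\<^bsub>?Q\<^esub> A') = f ` A \<oplus>\<^bsub>?Q'\<^esub> f ` A'"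
      unfolding quotient_module_sel(2) by (simp add: image_UN)
  next
    fix r A assume r: "r \<in> carrier R" and "A \<in> carrier ?Q"
    then have A: "a \<in> carrier M" if "a \<in> A" for a using sub that by blast
    have "f ` (r \<odot>\<^bsub>?Q\<^esub> A) = (\<Union>a\<in>A. (\<lambda>h. f (h \<oplus>\<^bsub>M\<^esub> (r \<odot>\<^bsub>M\<^esub> a))) ` B)"
      unfolding quotient_module_sel by (simp add: image_UN image_image)
    also have "\<dots> = (\<Union>a\<in>A. (\<lambda>h. f h \<oplus>\<^bsub>N\<^esub> (r \<odot>\<^bsub>N\<^esub> f a)) ` B)"
      using A r by (intro SUP_cong refl) (simp add: coset flip: smult)
    also have "\<dots> = r \<odot>\<^bsub>?Q'\<^esub> f ` A"
      unfolding quotient_module_sel by (simp add: image_image)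
    finally show "f ` (r \<odot>\<^bsub>?Q\<^esub> A) = r \<odot>\<^bsub>?Q'\<^esub> f ` A" .
  qed
  then show ?thesis by (auto simp: modules_isomorphic_def)
qed

lemma direct_sum_sel:
  "carrier (direct_sum M N) = carrier M \<times> carrier N"
  "\<zero>\<^bsub>direct_sum M N\<^esub> = (\<zero>\<^bsub>M\<^esub>, \<zero>\<^bsub>N\<^esub>)"
  "(x, y) \<oplus>\<^bsub>direct_sum M N\<^esub> (x', y') = (x \<oplus>\<^bsub>M\<^esub> x', y \<oplus>\<^bsub>N\<^esub> y')"
  "r \<odot>\<^bsub>direct_sum M N\<^esub> (x, y) = (r \<odot>\<^bsub>M\<^esub> x, r \<odot>\<^bsub>N\<^esub> y)"
  by (simp_all add: direct_sum_def)

lemma abelian_group_direct_sum: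
  assumes "abelian_group M" "abelian_group N"
  shows "abelian_group (direct_sum M N)"
proof -
  interpret M: abelian_group M by fact
  interpret N: abelian_group N by fact
  show ?thesis
  proof (rule abelian_groupI)
    fix x assume "x \<in> carrier (direct_sum M N)"
    then obtain a b where "x = (a, b)" "a \<in> carrier M" "b \<in> carrier N"
      by (auto simp: direct_sum_sel)
    then have "(\<ominus>\<^bsub>M\<^esub> a, \<ominus>\<^bsub>N\<^esub> b) \<in> carrier (direct_sum M N)"
      "(\<ominus>\<^bsub>M\<^esub> a, \<ominus>\<^bsub>N\<^esub> b) \<oplus>\<^bsub>direct_sum M N\<^esub> x = \<zero>\<^bsub>direct_sum M N\<^esub>"
      by (simp_all add: direct_sum_sel M.l_neg N.l_neg)
    then show "\<exists>y\<in>carrier (direct_sum M N). y \<oplus>\<^bsub>direct_sum M N\<^esub> x = \<zero>\<^bsub>direct_sum M N\<^esub>" by blast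
  next
    fix x y assume "x \<in> carrier (direct_sum M N)" "y \<in> carrier (direct_sum M N)"
    then show "x \<oplus>\<^bsub>direct_sum M N\<^esub> y = y \<oplus>\<^bsub>direct_sum M N\<^esub> x"
      by (auto simp: direct_sum_sel M.a_comm N.a_comm)
  qed (auto simp: direct_sum_sel M.a_assoc N.a_assoc)
qed

lemma UN_pairs: "(\<Union>x\<in>S \<times> T. F x) = (\<Union>a\<in>S. \<Union>b\<in>T. F (a, b))"
  by blast

text \<open>
  A coset of \<open>B \<times> B'\<close> is a product of cosets. A product of sets determines its factors only if
  they are nonempty, whence the assumptions.
\<close>

lemma quotient_direct_sum:
  assumes "B \<noteq> {}" "B' \<noteq> {}"
  shows "modules_isomorphic R
    (quotient_module ((direct_sum M N)\<lparr>carrier := Z \<times> Z'\<rparr>) (B \<times> B'))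
    (direct_sum (quotient_module (M\<lparr>carrier := Z\<rparr>) B) (quotient_module (N\<lparr>carrier := Z'\<rparr>) B'))"
    (is "modules_isomorphic R ?Q (direct_sum ?P ?P')")
proof -
  have coset: "(\<lambda>h. h \<oplus>\<^bsub>direct_sum M N\<^esub> (z, z')) ` (B \<times> B')
      = (\<lambda>h. h \<oplus>\<^bsub>M\<^esub> z) ` B \<times> (\<lambda>h. h \<oplus>\<^bsub>N\<^esub> z') ` B'" for z z'
    by (force simp: direct_sum_sel)
  have carr: "carrier ?Q = (\<lambda>(A, A'). A \<times> A') ` (carrier ?P \<times> carrier ?P')"
  proof -
    let ?K = "\<lambda>z. (\<lambda>h. h \<oplus>\<^bsub>M\<^esub> z) ` B" and ?K' = "\<lambda>z. (\<lambda>h. h \<oplus>\<^bsub>N\<^esub> z) ` B'"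
    have "carrier ?Q = (\<lambda>z. (\<lambda>(A, A'). A \<times> A') (map_prod ?K ?K' z)) ` (Z \<times> Z')"
      unfolding quotient_module_sel
    proof (rule image_cong [OF refl])
      fix z
      show "(\<lambda>h. h \<oplus>\<^bsub>direct_sum M N\<^esub> z) ` (B \<times> B') = (\<lambda>(A, A'). A \<times> A') (map_prod ?K ?K' z)"
        by (cases z) (simp only: coset map_prod_simp prod.case)
    qed
    also have "\<dots> = (\<lambda>(A, A'). A \<times> A') ` map_prod ?K ?K' ` (Z \<times> Z')"
      by (simp only: image_image)
    also have "map_prod ?K ?K' ` (Z \<times> Z') = carrier ?P \<times> carrier ?P'"
      unfolding quotient_module_sel by (rule map_prod_surj_on) simp_all
    finally show ?thesis .
  qed
  have empty: "{} \<notin> carrier ?P" "{} \<notin> carrier ?P'"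
    using assms by (auto simp: quotient_module_sel)
  then have ne: "A \<noteq> {}" "A' \<noteq> {}" if "A \<in> carrier ?P" "A' \<in> carrier ?P'" for A A'
    using that by auto
  have proj: "fst ` (A \<times> A') = A" "snd ` (A \<times> A') = A'" if "A \<in> carrier ?P" "A' \<in> carrier ?P'" for A A'
    using ne [OF that] by simp_all
  have "(\<lambda>A. (fst ` A, snd ` A)) \<in> module_iso R ?Q (direct_sum ?P ?P')"
  proof (rule module_isoI)
    show "bij_betw (\<lambda>A. (fst ` A, snd ` A)) (carrier ?Q) (carrier (direct_sum ?P ?P'))"
      unfolding carr direct_sum_sel
      by (rule bij_betw_byWitness [where f' = "\<lambda>(A, A'). A \<times> A'"])
        (auto simp: proj empty simp del: fst_image_times snd_image_times)
  next
    fix X Y assume "X \<in> carrier ?Q" "Y \<in> carrier ?Q"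
    then obtain A A' D D' where XY: "X = A \<times> A'" "Y = D \<times> D'"
      and mem: "A \<in> carrier ?P" "A' \<in> carrier ?P'" "D \<in> carrier ?P" "D' \<in> carrier ?P'"
      unfolding carr by auto
    have "X \<oplus>\<^bsub>?Q\<^esub> Y = (A \<oplus>\<^bsub>?P\<^esub> D) \<times> (A' \<oplus>\<^bsub>?P'\<^esub> D')"
      unfolding quotient_module_sel XY UN_pairs direct_sum_sel by blast
    moreover have "A \<oplus>\<^bsub>?P\<^esub> D \<noteq> {}" "A' \<oplus>\<^bsub>?P'\<^esub> D' \<noteq> {}"
      unfolding quotient_module_sel using ne mem by auto
    ultimately show "(fst ` (X \<oplus>\<^bsub>?Q\<^esub> Y), snd ` (X \<oplus>\<^bsub>?Q\<^esub> Y))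
        = (fst ` X, snd ` X) \<oplus>\<^bsub>direct_sum ?P ?P'\<^esub> (fst ` Y, snd ` Y)"
      using mem by (simp add: direct_sum_sel XY proj del: fst_image_times snd_image_times) simp
  next
    fix r X assume "r \<in> carrier R" "X \<in> carrier ?Q"
    then obtain A A' where X: "X = A \<times> A'"
      and mem: "A \<in> carrier ?P" "A' \<in> carrier ?P'"
      unfolding carr by auto
    have "r \<odot>\<^bsub>?Q\<^esub> X = (r \<odot>\<^bsub>?P\<^esub> A) \<times> (r \<odot>\<^bsub>?P'\<^esub> A')"
      unfolding quotient_module_sel X UN_pairs direct_sum_sel coset
      using ne [OF mem] by blast
    moreover have "r \<odot>\<^bsub>?P\<^esub> A \<noteq> {}" "r \<odot>\<^bsub>?P'\<^esub> A' \<noteq> {}"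
      unfolding quotient_module_sel using ne [OF mem] assms by auto
    ultimately show "(fst ` (r \<odot>\<^bsub>?Q\<^esub> X), snd ` (r \<odot>\<^bsub>?Q\<^esub> X))
        = r \<odot>\<^bsub>direct_sum ?P ?P'\<^esub> (fst ` X, snd ` X)"
      using mem by (simp add: direct_sum_sel X proj del: fst_image_times snd_image_times) simp
  qed
  then show ?thesis by (auto simp: modules_isomorphic_def)
qed

lemma homology_isomorphic:
  assumes mod: "\<And>i. Module.module R (chain_module C i)" and grp: "\<And>i. abelian_group (chain_module D i)"
    and bdry: "\<And>i x. x \<in> carrier (chain_module C i) \<Longrightarrow> bdry C i x \<in> carrier (chain_module C (i + 1))"
    and iso: "\<And>i. \<phi> i \<in> module_iso R (chain_module C i) (chain_module D i)"
    and comm: "\<And>i x. x \<in> carrier (chain_module C i) \<Longrightarrow>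
      \<phi> (i + 1) (bdry C i x) = bdry D i (\<phi> i x)"
  shows "modules_isomorphic R (homology C i) (homology D i)"
proof -
  have onto: "\<phi> i ` carrier (chain_module C i) = carrier (chain_module D i)" for i
    using module_isoD(1) [OF iso] by (rule bij_betw_imp_surj_on)
  have ker: "bdry D i (\<phi> i x) = \<zero>\<^bsub>chain_module D (i + 1)\<^esub> \<longleftrightarrow>
      bdry C i x = \<zero>\<^bsub>chain_module C (i + 1)\<^esub>" if x: "x \<in> carrier (chain_module C i)" for i x
  proof -
    interpret Module.module R "chain_module C (i + 1)" by (rule mod)
    have "\<phi> (i + 1) \<zero>\<^bsub>chain_module C (i + 1)\<^esub> = \<zero>\<^bsub>chain_module D (i + 1)\<^esub>"
      by (rule module_iso_zero [OF iso M.abelian_group_axioms grp])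
    then show ?thesis
      using inj_on_eq_iff [OF bij_betw_imp_inj_on [OF module_isoD(1) [OF iso [of "i + 1"]]]
          bdry [OF x] M.zero_closed] comm [OF x] by simp
  qed
  have cyc: "\<phi> i ` cycles C i = cycles D i"
    unfolding cycles_def onto [symmetric] using ker by auto
  have bd: "\<phi> i ` boundaries C i = boundaries D i"
    unfolding boundaries_def onto [symmetric] image_image
    using comm [of _ "i - 1"] by (intro image_cong) simp_all
  have "cycles C i \<subseteq> carrier (chain_module C i)" by (auto simp: cycles_def)
  moreover have "boundaries C i \<subseteq> carrier (chain_module C i)"
    using bdry [of _ "i - 1"] by (auto simp: boundaries_def)
  ultimately show ?thesis
    unfolding homology_def cyc [symmetric] bd [symmetric]
    by (rule quotient_module_transport [OF mod iso])
qed

definition direct_sum_complex ::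
    "('r, 'a) graded_complex \<Rightarrow> ('r, 'b) graded_complex \<Rightarrow> ('r, 'a \<times> 'b) graded_complex" where
  "direct_sum_complex C D =
     \<lparr>chain_module = (\<lambda>i. direct_sum (chain_module C i) (chain_module D i)),
      bdry = (\<lambda>i (x, y). (bdry C i x, bdry D i y)),
      homog = (\<lambda>i q. homog C i q \<times> homog D i q)\<rparr>"

lemma homology_direct_sum:
  assumes "\<And>i. carrier (chain_module C i) \<noteq> {}" "\<And>i. carrier (chain_module D i) \<noteq> {}"
  shows "modules_isomorphic R (homology (direct_sum_complex C D) i)
    (direct_sum (homology C i) (homology D i))"
proof -
  have "cycles (direct_sum_complex C D) i = cycles C i \<times> cycles D i"
    by (auto simp: cycles_def direct_sum_complex_def direct_sum_sel)
  moreover have "boundaries (direct_sum_complex C D) i = boundaries C i \<times> boundaries D i"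
    by (force simp: boundaries_def direct_sum_complex_def direct_sum_sel)
  ultimately show ?thesis
    unfolding homology_def
    using assms by (simp add: direct_sum_complex_def quotient_direct_sum boundaries_def)
qed

section \<open>The splitting\<close>

lemma not_L1_iff: "l \<noteq> L1 \<longleftrightarrow> l = LX"
  by (cases l) simp_all

locale based_diagram =
  fixes L :: "'e diagram" and p :: 'e
  assumes finite_arcs: "finite (arcs L)" and base_arc: "p \<in> arcs L"
begin

abbreviation X :: "'e chain \<Rightarrow> 'e chain" where "X \<equiv> dot L p"
abbreviation D :: "'e chain \<Rightarrow> 'e chain" where "D \<equiv> conj_quot L"
abbreviation d :: "'e chain \<Rightarrow> 'e chain" where "d \<equiv> bn_diff L"
abbreviation \<pi> :: "'e chain \<Rightarrow> 'e chain" where "\<pi> \<equiv> proj (based_generators L p L1)"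
abbreviation H :: "'e chain \<Rightarrow> 'e chain" where "H \<equiv> scale H_var"
abbreviation chain_group :: "int \<Rightarrow> 'e chain set" where
  "chain_group i \<equiv> supported {g \<in> generators L. hdeg L g = i}"

lemma linear_op_proj: "linear_op \<pi>"
  by (auto simp: linear_op_def proj_def fun_eq_iff chain_apply)

lemmas linear_ops = linear_op_dot [of L p] linear_op_conj_quot [of L] linear_op_bn_diff [of L] linear_op_proj

lemmas op_simps =
  linear_ops [THEN linear_op_add] linear_ops [THEN linear_op_scale] linear_ops [THEN linear_op_zero]

lemma chains_generators: "x \<in> chain_group i \<Longrightarrow> x \<in> supported (generators L)"
  by (auto simp: supported_def)

lemma D_chains: "x \<in> chain_group i \<Longrightarrow> D x \<in> chain_group i"
proof -
  \<comment> \<open>The homological degree depends only on the vertex of the cube, which \<open>D\<close> does not change.\<close>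
  have *: "{g \<in> generators L. hdeg L g = i}
      = {g \<in> generators L. int (weight (fst g)) - int (n_neg L) = i}"
    by (auto simp: hdeg_def)
  show "x \<in> chain_group i \<Longrightarrow> D x \<in> chain_group i"
    unfolding * by (rule conj_quot_supported)
qed

lemmas X_chains = dot_supported [OF base_arc]
lemmas X_X = dot_dot [of L p]

lemma \<pi>_chains: "x \<in> chain_group i \<Longrightarrow> \<pi> x \<in> chain_group i"
  by (auto simp: supported_def proj_def)

lemma d_chains: "x \<in> chain_group i \<Longrightarrow> d x \<in> chain_group (i + 1)"
  by (rule bn_diff_supported)

lemma X_d: "x \<in> chain_group i \<Longrightarrow> X (d x) = d (X x)"
  by (rule dot_bn_diff [OF finite_arcs base_arc chains_generators])

lemma D_d: "x \<in> chain_group i \<Longrightarrow> D (d x) = d (D x)"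
  by (rule conj_quot_bn_diff [OF finite_arcs chains_generators])

lemma D_D: "x \<in> chain_group i \<Longrightarrow> D (D x) = 0"
  by (rule conj_quot_conj_quot [OF finite_arcs chains_generators])

lemma D_X: "D (X x) = X (D x) + (x + H (D x))"
  by (simp add: conj_quot_dot [OF finite_arcs base_arc] conj_map_eq [OF finite_arcs])

lemma \<pi>_X: "\<pi> (X x) = 0"
  by (auto simp: fun_eq_iff chain_apply proj_def dot_def based_generators_def)

lemma \<pi>_\<pi>: "\<pi> (\<pi> x) = \<pi> x"
  by (auto simp: fun_eq_iff proj_def)

text \<open>
  The subcomplex \<open>C\<^sub>x\<close> is the kernel of the projection to \<open>C\<^sub>1\<close>; describing it as the eigenspace
  \<open>X = H\<close> makes it accessible to the operator relations.
\<close>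

lemma \<pi>_eq_0_iff:
  assumes x: "x \<in> chain_group i"
  shows "\<pi> x = 0 \<longleftrightarrow> X x = H x"
proof
  assume 0: "\<pi> x = 0"
  have L1: "x (\<alpha>, v) = 0" if "v (base_circle L p \<alpha>) = L1" for \<alpha> v
  proof (cases "(\<alpha>, v) \<in> generators L")
    case True
    then have "(\<alpha>, v) \<in> based_generators L p L1" using that by (simp add: based_generators_def)
    then show ?thesis using fun_cong [OF 0, of "(\<alpha>, v)"] by (simp add: proj_def chain_apply)
  next
    case False
    then show ?thesis using chains_generators [OF x] by (simp add: supported_def)
  qed
  show "X x = H x"
  proof (rule ext)
    fix g :: "'e generator"
    obtain \<alpha> v where g: "g = (\<alpha>, v)" by force
    show "X x g = H x g"
      by (cases "v (base_circle L p \<alpha>)") (simp_all add: g dot_def scale_apply L1)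
  qed
next
  assume X: "X x = H x"
  have "H_var \<noteq> 0" by (simp add: H_var_def)
  then have "x g = 0" if "g \<in> based_generators L p L1" for g
    using that fun_cong [OF X, of g] by (auto simp: based_generators_def dot_def scale_apply)
  then show "\<pi> x = 0" by (auto simp: fun_eq_iff proj_def chain_apply)
qed

definition dot_eigenspace :: "int \<Rightarrow> 'e chain set" where
  "dot_eigenspace i = {x \<in> chain_group i. X x = H x}"

lemma add_\<pi>_eigenspace: "x \<in> chain_group i \<Longrightarrow> x + \<pi> x \<in> dot_eigenspace i"
  unfolding dot_eigenspace_def
  using \<pi>_eq_0_iff [of "x + \<pi> x" i] \<pi>_chains [of x i]
  by (simp add: supported_add op_simps \<pi>_\<pi>)

lemma X_eigenspace: "x \<in> chain_group i \<Longrightarrow> X x \<in> dot_eigenspace i"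
  by (simp add: dot_eigenspace_def X_chains X_X)

lemma d_eigenspace: "x \<in> dot_eigenspace i \<Longrightarrow> d x \<in> dot_eigenspace (i + 1)"
  by (auto simp: dot_eigenspace_def d_chains X_d op_simps)

lemma eigenspace_\<pi>: "x \<in> dot_eigenspace i \<Longrightarrow> \<pi> x = 0"
  using \<pi>_eq_0_iff by (auto simp: dot_eigenspace_def)

text \<open>\<open>D X = X D + 1 + H D\<close> and \<open>D X = H D\<close> on the eigenspace leave \<open>X D = 1\<close>.\<close>

lemma X_D_eigenspace:
  assumes "x \<in> dot_eigenspace i"
  shows "X (D x) = x"
proof -
  have "H (D x) = X (D x) + (x + H (D x))"
    using assms D_X [of x] by (simp add: dot_eigenspace_def op_simps)
  then have "X (D x) + H (D x) = X (D x) + (X (D x) + (x + H (D x)))" by simp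
  then show ?thesis by simp
qed

text \<open>
  The isomorphism \<open>X \<sigma>\<close>. It kills \<open>C\<^sub>x\<close> because \<open>X \<sigma> = X + H X D\<close> is \<open>H + H = 0\<close> there, so it
  is defined on the quotient \<open>C\<^sub>1\<close>, and it is inverted by \<open>\<pi> D\<close>.
\<close>

definition \<phi> :: "'e chain \<Rightarrow> 'e chain" where
  "\<phi> x = X (x + H (D x))"

lemma \<phi>_add: "\<phi> (x + y) = \<phi> x + \<phi> y"
  and \<phi>_scale: "\<phi> (scale r x) = scale r (\<phi> x)"
  by (simp_all add: \<phi>_def op_simps scale_add scale_scale mult.commute add_ac)

lemma \<phi>_eigenspace:
  assumes "x \<in> dot_eigenspace i"
  shows "\<phi> x = 0"
  using assms X_D_eigenspace [OF assms] by (simp add: \<phi>_def op_simps dot_eigenspace_def)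

lemma \<phi>_\<pi>:
  assumes "x \<in> chain_group i"
  shows "\<phi> (\<pi> x) = \<phi> x"
proof -
  have "\<phi> x + \<phi> (\<pi> x) = 0" using \<phi>_eigenspace [OF add_\<pi>_eigenspace [OF assms]] by (simp add: \<phi>_add)
  then have "\<phi> x + (\<phi> x + \<phi> (\<pi> x)) = \<phi> x" by simp
  then show ?thesis by (simp only: chain_add_cancel)
qed

lemma \<phi>_in_eigenspace: "x \<in> chain_group i \<Longrightarrow> \<phi> x \<in> dot_eigenspace i"
  unfolding \<phi>_def by (intro X_eigenspace supported_add supported_scale D_chains)

lemma \<phi>_\<pi>_D:
  assumes "x \<in> dot_eigenspace i"
  shows "\<phi> (\<pi> (D x)) = x"
proof -
  have x: "x \<in> chain_group i" using assms by (simp add: dot_eigenspace_def)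
  have "\<phi> (\<pi> (D x)) = \<phi> (D x)" by (rule \<phi>_\<pi> [OF D_chains [OF x]])
  also have "\<dots> = X (D x)" by (simp add: \<phi>_def D_D [OF x] scale_zero)
  finally show ?thesis by (simp add: X_D_eigenspace [OF assms])
qed

lemma \<pi>_D_\<phi>:
  assumes "x \<in> chain_group i"
  shows "\<pi> (D (\<phi> x)) = \<pi> x"
proof -
  have "D (\<phi> x) = X (D x) + x"
    by (simp add: \<phi>_def D_X op_simps D_D [OF assms] scale_zero add_ac)
  then show ?thesis by (simp add: op_simps \<pi>_X)
qed

lemma \<phi>_d:
  assumes "x \<in> chain_group i"
  shows "\<phi> (d x) = d (\<phi> x)"
  by (simp add: \<phi>_def op_simps X_d [OF assms] D_d [OF assms] X_d [OF D_chains [OF assms]])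

lemma carriers:
  "chain_module (C_BN L) i = free_module {g \<in> generators L. hdeg L g = i}"
  "carrier (chain_module (C_BN L) i) = chain_group i"
  "carrier (chain_module (C_x L p) i) = dot_eigenspace i"
  "carrier (chain_module (C_1 L p) i) = {x \<in> chain_group i. \<pi> x = x}"
proof -
  show "chain_module (C_BN L) i = free_module {g \<in> generators L. hdeg L g = i}"
    "carrier (chain_module (C_BN L) i) = chain_group i"
    by (simp_all add: C_BN_def complex_on_def free_module_sel)
  have "based_generators L p LX = generators L - based_generators L p L1"
    by (auto simp: based_generators_def not_L1_iff)
  then have "supported {g \<in> based_generators L p LX. hdeg L g = i} = {x \<in> chain_group i. \<pi> x = 0}"
    by (auto simp: supported_def proj_def fun_eq_iff chain_apply)
  also have "\<dots> = dot_eigenspace i"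
    using \<pi>_eq_0_iff by (auto simp: dot_eigenspace_def)
  finally show "carrier (chain_module (C_x L p) i) = dot_eigenspace i"
    by (simp add: C_x_def complex_on_def free_module_sel)
  have "based_generators L p L1 \<subseteq> generators L" by (auto simp: based_generators_def)
  then show "carrier (chain_module (C_1 L p) i) = {x \<in> chain_group i. \<pi> x = x}"
    by (auto simp: C_1_def complex_on_def free_module_sel supported_def proj_def fun_eq_iff)
qed


lemma homog_reduced:
  "homog (C_x L p) i q = {x \<in> dot_eigenspace i. homogeneous L q x}"
  "homog (qshift (- 2) (C_1 L p)) i q = {x \<in> chain_group i. \<pi> x = x \<and> homogeneous L (q + 2) x}"
  using carriers(3,4) [of i]
  by (auto simp: C_x_def C_1_def qshift_def complex_on_def homogeneous_def)

lemma modules: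
  "Module.module F2H (chain_module (C_BN L) i)"
  "Module.module F2H (chain_module (C_x L p) i)"
  "Module.module F2H (chain_module (C_1 L p) i)"
  by (simp_all add: C_BN_def C_x_def C_1_def complex_on_def module_free_module)

lemma operations:
  "x \<oplus>\<^bsub>chain_module (C_BN L) i\<^esub> y = x + y" "r \<odot>\<^bsub>chain_module (C_BN L) i\<^esub> x = scale r x"
  "x \<oplus>\<^bsub>chain_module (C_x L p) i\<^esub> y = x + y" "r \<odot>\<^bsub>chain_module (C_x L p) i\<^esub> x = scale r x"
  "x \<oplus>\<^bsub>chain_module (C_1 L p) i\<^esub> y = x + y" "r \<odot>\<^bsub>chain_module (C_1 L p) i\<^esub> x = scale r x"
  by (simp_all add: C_BN_def C_x_def C_1_def complex_on_def free_module_sel)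

lemma differentials:
  "bdry (C_BN L) i = d" "bdry (C_x L p) i = d" "bdry (C_1 L p) i = (\<lambda>x. \<pi> (d x))"
  by (simp_all add: C_BN_def C_x_def C_1_def complex_on_def comp_def)

lemma \<phi>_iso: "\<phi> \<in> module_iso F2H (chain_module (C_1 L p) i) (chain_module (C_x L p) i)"
proof (rule module_isoI)
  show "bij_betw \<phi> (carrier (chain_module (C_1 L p) i)) (carrier (chain_module (C_x L p) i))"
    unfolding carriers
  proof (rule bij_betw_byWitness [where f' = "\<lambda>x. \<pi> (D x)"])
    show "\<forall>x\<in>{x \<in> chain_group i. \<pi> x = x}. \<pi> (D (\<phi> x)) = x"
      by (auto simp: \<pi>_D_\<phi>)
    show "\<forall>x\<in>dot_eigenspace i. \<phi> (\<pi> (D x)) = x"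
      by (simp add: \<phi>_\<pi>_D)
    show "\<phi> ` {x \<in> chain_group i. \<pi> x = x} \<subseteq> dot_eigenspace i"
      using \<phi>_in_eigenspace by blast
    show "(\<lambda>x. \<pi> (D x)) ` dot_eigenspace i \<subseteq> {x \<in> chain_group i. \<pi> x = x}"
      by (auto simp: dot_eigenspace_def \<pi>_chains D_chains \<pi>_\<pi>)
  qed
qed (simp_all add: operations \<phi>_add \<phi>_scale)

text \<open>
  The differential of \<open>C\<^sub>1\<close> differs from \<open>d\<close> by elements of \<open>C\<^sub>x\<close>, which \<open>\<phi>\<close> does not see.
\<close>

lemma \<phi>_chain_map:
  assumes "x \<in> carrier (chain_module (C_1 L p) i)"
  shows "\<phi> (bdry (C_1 L p) i x) = bdry (C_x L p) i (\<phi> x)"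
proof -
  have x: "x \<in> chain_group i" using assms by (simp add: carriers)
  show ?thesis by (simp add: differentials \<phi>_\<pi> [OF d_chains [OF x]] \<phi>_d [OF x])
qed

lemma homogeneous_\<phi>:
  assumes "homogeneous L (q + 2) x"
  shows "homogeneous L q (\<phi> x)"
proof -
  have "homogeneous L (q + 2) (H (D x))"
    using homogeneous_conj_quot [OF finite_arcs assms] by (rule homogeneous_scale_H)
  then show ?thesis
    unfolding \<phi>_def by (intro homogeneous_dot [OF finite_arcs base_arc] homogeneous_add assms)
qed

lemma homogeneous_\<pi>: "homogeneous L q x \<Longrightarrow> homogeneous L q (\<pi> x)"
  by (auto simp: homogeneous_def proj_def)

lemma \<phi>_homog: "\<phi> ` homog (qshift (- 2) (C_1 L p)) i q = homog (C_x L p) i q"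
proof
  show "\<phi> ` homog (qshift (- 2) (C_1 L p)) i q \<subseteq> homog (C_x L p) i q"
    unfolding homog_reduced using \<phi>_in_eigenspace homogeneous_\<phi> by blast
  show "homog (C_x L p) i q \<subseteq> \<phi> ` homog (qshift (- 2) (C_1 L p)) i q"
  proof
    fix x assume "x \<in> homog (C_x L p) i q"
    then have x: "x \<in> dot_eigenspace i" "x \<in> chain_group i" "homogeneous L q x"
      by (auto simp: homog_reduced dot_eigenspace_def)
    then have "\<pi> (D x) \<in> homog (qshift (- 2) (C_1 L p)) i q"
      unfolding homog_reduced
      by (simp add: \<pi>_chains D_chains \<pi>_\<pi> homogeneous_\<pi> homogeneous_conj_quot [OF finite_arcs])
    then show "x \<in> \<phi> ` homog (qshift (- 2) (C_1 L p)) i q"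
      using \<phi>_\<pi>_D [OF x(1)] by (metis imageI)
  qed
qed

lemma reduced_complexes_isomorphic:
  "graded_complexes_isomorphic F2H (qshift (- 2) (C_1 L p)) (C_x L p)"
  unfolding graded_complexes_isomorphic_def
  using \<phi>_iso \<phi>_chain_map \<phi>_homog
  by (intro exI [of _ "\<lambda>_. \<phi>"]) (simp add: qshift_def)

lemma reduced_homologies_isomorphic:
  "modules_isomorphic F2H (homology (C_1 L p) i) (homology (C_x L p) i)"
proof (rule homology_isomorphic [where \<phi> = "\<lambda>_. \<phi>"])
  show "abelian_group (chain_module (C_x L p) i)" for i
    using modules(2) by (rule module.axioms)
  show "bdry (C_1 L p) i x \<in> carrier (chain_module (C_1 L p) (i + 1))"
    if "x \<in> carrier (chain_module (C_1 L p) i)" for i x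
    using that by (simp add: carriers differentials \<pi>_chains d_chains \<pi>_\<pi>)
qed (fact modules(3) \<phi>_iso \<phi>_chain_map)+

definition split_map :: "'e chain \<Rightarrow> 'e chain \<times> 'e chain" where
  "split_map x = (X (D x), \<pi> x)"

text \<open>
  The summand \<open>C\<^sub>1\<close> is embedded as the kernel of the retraction \<open>X D\<close>, by \<open>b \<mapsto> b + X D b\<close>.
\<close>

lemma split_map_bij: "bij_betw split_map (chain_group i) (dot_eigenspace i \<times> {x \<in> chain_group i. \<pi> x = x})"
proof (rule bij_betw_byWitness [where f' = "\<lambda>(a, b). a + (b + X (D b))"])
  have "X (D x) + (\<pi> x + X (D (\<pi> x))) = x" if "x \<in> chain_group i" for x
  proof -
    have "X (D x) + X (D (\<pi> x)) = x + \<pi> x"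
      using X_D_eigenspace [OF add_\<pi>_eigenspace [OF that]] by (simp add: op_simps)
    then have "X (D x) + (\<pi> x + X (D (\<pi> x))) = \<pi> x + (x + \<pi> x)"
      by (metis add.left_commute)
    then show ?thesis by (simp add: add.left_commute)
  qed
  then show "\<forall>x\<in>chain_group i. (case split_map x of (a, b) \<Rightarrow> a + (b + X (D b))) = x"
    by (simp add: split_map_def)
  have "split_map (a + (b + X (D b))) = (a, b)"
    if "a \<in> dot_eigenspace i" "b \<in> chain_group i" "\<pi> b = b" for a b
    using X_D_eigenspace [OF that(1)] X_D_eigenspace [OF X_eigenspace [OF D_chains [OF that(2)]]]
      eigenspace_\<pi> [OF that(1)] that(3)
    by (simp add: split_map_def op_simps \<pi>_X)
  then show "\<forall>y\<in>dot_eigenspace i \<times> {x \<in> chain_group i. \<pi> x = x}.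
      split_map (case y of (a, b) \<Rightarrow> a + (b + X (D b))) = y"
    by auto
  show "split_map ` chain_group i \<subseteq> dot_eigenspace i \<times> {x \<in> chain_group i. \<pi> x = x}"
    by (auto simp: split_map_def X_eigenspace D_chains \<pi>_chains \<pi>_\<pi>)
  show "(\<lambda>(a, b). a + (b + X (D b))) ` (dot_eigenspace i \<times> {x \<in> chain_group i. \<pi> x = x}) \<subseteq> chain_group i"
    by (auto simp: dot_eigenspace_def intro!: supported_add X_chains D_chains)
qed

lemma split_map_chain_map:
  assumes "x \<in> chain_group i"
  shows "split_map (d x) = (d (X (D x)), \<pi> (d (\<pi> x)))"
proof -
  have "\<pi> (d (x + \<pi> x)) = 0"
    by (rule eigenspace_\<pi> [OF d_eigenspace [OF add_\<pi>_eigenspace [OF assms]]])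
  then have "\<pi> (d x) = \<pi> (d (\<pi> x))" by (simp add: op_simps)
  then show ?thesis
    by (simp add: split_map_def D_d [OF assms] X_d [OF D_chains [OF assms]])
qed

lemma homology_splits:
  "modules_isomorphic F2H (homology (C_BN L) i)
     (direct_sum (homology (C_x L p) i) (homology (C_1 L p) i))"
proof (rule modules_isomorphic_trans)
  let ?S = "direct_sum_complex (C_x L p) (C_1 L p)"
  show "modules_isomorphic F2H (homology (C_BN L) i) (homology ?S i)"
  proof (rule homology_isomorphic [where \<phi> = "\<lambda>_. split_map"])
    show "abelian_group (chain_module ?S i)" for i
      using modules(2,3) [THEN module.axioms(2)]
      by (simp add: direct_sum_complex_def abelian_group_direct_sum)
    show "bdry (C_BN L) i x \<in> carrier (chain_module (C_BN L) (i + 1))"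
      if "x \<in> carrier (chain_module (C_BN L) i)" for i x
      using that unfolding carriers(2) differentials by (rule d_chains)
    show "split_map \<in> module_iso F2H (chain_module (C_BN L) i) (chain_module ?S i)" for i
    proof (rule module_isoI)
      show "bij_betw split_map (carrier (chain_module (C_BN L) i)) (carrier (chain_module ?S i))"
        unfolding carriers(2) direct_sum_complex_def
        by (simp add: direct_sum_sel carriers split_map_bij)
    qed (simp_all add: direct_sum_complex_def direct_sum_sel operations split_map_def op_simps)
    show "split_map (bdry (C_BN L) i x) = bdry ?S i (split_map x)"
      if "x \<in> carrier (chain_module (C_BN L) i)" for i x
      using split_map_chain_map [of x i] that
      by (simp only: carriers(2) differentials direct_sum_complex_def graded_complex.simps)
        (simp add: split_map_def)
  qed (rule modules(1))
  have "0 \<in> dot_eigenspace i" "0 \<in> {x \<in> chain_group i. \<pi> x = x}" for i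
    by (simp_all add: dot_eigenspace_def supported_zero op_simps scale_zero)
  then have "carrier (chain_module (C_x L p) i) \<noteq> {}" "carrier (chain_module (C_1 L p) i) \<noteq> {}" for i
    unfolding carriers by blast+
  then show "modules_isomorphic F2H (homology ?S i)
      (direct_sum (homology (C_x L p) i) (homology (C_1 L p) i))"
    by (rule homology_direct_sum)
qed

end

theorem theorem4:
  fixes L :: "'e diagram" and p :: 'e
  assumes "oriented_link_diagram L" and "p \<in> arcs L"
  shows "graded_complexes_isomorphic F2H (qshift (-2) (C_1 L p)) (C_x L p) \<and>
    (\<forall>i. modules_isomorphic F2H (homology (C_BN L) i)
            (direct_sum (homology (C_x L p) i) (homology (C_1 L p) i))) \<and>
    (\<forall>i. modules_isomorphic F2H (homology (C_1 L p) i) (homology (C_x L p) i))"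
proof -
  interpret based_diagram L p
    using assms by unfold_locales (simp_all add: oriented_link_diagram_def)
  show ?thesis
    using reduced_complexes_isomorphic homology_splits reduced_homologies_isomorphic by blast
qed

end
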